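(* Let $(E,T,S,e)$ be a conditional expectation preserving system. Then the following statements are equivalent (all limits being order limits): (i) the system $(E,T,S,e)$ is ergodic; (ii) $\lim_{n\to\infty}\frac1n\sum_{k=0}^{n-1}T(f\,S^{k}g)=Tf\,Tg$ for all $f\in L^{\infty}(T)$ and $g\in L^{1}(T)$; (iii) $\lim_{n\to\infty}\frac1n\sum_{k=0}^{n-1}T(f\,S^{k}g)=Tf\,Tg$ for all $f,g\in E_{e}$; (iv) $\lim_{n\to\infty}\frac1n\sum_{k=0}^{n-1}T(f\,S^{k}g)=Tf\,Tg$ for all components $f,g$ of $e$; (v) $\lim_{n\to\infty}\frac1n\sum_{k=0}^{n-1}T(f\,S^{k}f)=(Tf)^{2}$ for all $f\in E_{e}$; (vi) $\lim_{n\to\infty}\frac1n\sum_{k=0}^{n-1}T(f\,S^{k}f)=(Tf)^{2}$ for all components $f$ of $e$.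
   Context: A conditional Riesz triple $(E,e,T)$ consists of a Dedekind complete Riesz space $E$, a weak order unit $e$ of $E$, and a conditional expectation operator $T$ on $E$, that is, a strictly positive order continuous linear projection $T:E\to E$ with $Te=e$ and Dedekind complete range $R(T)$. A conditional expectation preserving system is a 4-tuple $(E,T,S,e)$ where $(E,e,T)$ is a conditional Riesz triple and $S:E\to E$ is an order continuous Riesz (lattice) homomorphism with $Se=e$ and $TSf=Tf$ for all $f\in E$. The system is called ergodic if, for every $f\in E$, $Sf=f$ implies $Tf=f$. A component of $e$ is an element $p\in E$ with $p\wedge(e-p)=0$. $E_e=\{f\in E: |f|\le Me \text{ for some } M\in\mathbb{R}_+\}$ is the ideal generated by $e$. Let $E^u$ be the universal completion of $E$, equipped with its $f$-algebra structure with multiplicative unit $e$; all products are taken in $E^u$, and order limits are taken in $E^u$. The natural domain of $T$ is $L^1(T)=D-D\subseteq E^u$, where $D$ is the set of $x\in E^u_+$ for which there is a net $(x_\alpha)$ in $E_+$ with $0\le x_\alpha\uparrow x$ and $(Tx_\alpha)$ order bounded in $E^u$. The operator $T$ is extended to $L^1(T)$ by $Tx=\sup_\alpha Tx_\alpha$ for $x\in D$ with $(x_\alpha)$ such a net, and by linearity; this extension, again denoted $T$, is a conditional expectation operator on $L^1(T)$, and $R(T)$ denotes its range in what follows. The map $S$ has a unique extension to an order continuous Riesz homomorphism $L^1(T)\to L^1(T)$, again denoted $S$, given by $Sx=\sup_\alpha Sx_\alpha$ whenever $x_\alpha\in E_+$ and $x_\alpha\uparrow x\in L^1(T)_+$;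 it satisfies $TS=T$ on $L^1(T)$. Finally $L^\infty(T)=\{f\in L^1(T): |f|\le u\text{ for some }u\in R(T)\}$; for $f\in L^\infty(T)$ and $g\in L^1(T)$ one has $fg\in L^1(T)$. *)

theory Defs
  imports "HOL-Analysis.Analysis" "HOL-Library.Lattice_Algebras"
begin

section \<open>Riesz spaces and universally complete f-algebras\<close>

class riesz_space = ordered_real_vector + lattice_ab_group_add_abs

text \<open>
  Dedekind completeness comes from the class of conditionally complete lattices.  Given it, a set
  has a supremum as soon as it is nonempty and bounded above, so the first axiom is lateral
  completeness; the second is the f-algebra axiom.  Commutativity is not an extra restriction:
  every Archimedean f-algebra is commutative.  No multiplicative unit is built into the class,
  because the unit has to be a given weak order unit.
\<close>

class universally_complete_f_algebra =
  riesz_space + lattice_ring + real_algebra + comm_ring + conditionally_complete_lattice +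
  assumes laterally_complete:
      "(\<And>x. x \<in> A \<Longrightarrow> 0 \<le> x) \<Longrightarrow> pairwise (\<lambda>x y. inf x y = 0) A \<Longrightarrow> bdd_above A"
    and f_algebra: "inf x y = 0 \<Longrightarrow> 0 \<le> z \<Longrightarrow> inf (z * x) y = 0"


section \<open>Order notions relative to a subset\<close>

text \<open>
  A Riesz space \<open>E\<close> is represented by a Riesz subspace of a type of class
  \<^class>\<open>riesz_space\<close>.  Suprema, infima and order limits in \<open>E\<close> are formed inside \<open>E\<close>; operators
  on \<open>E\<close> are total functions of which only the values on \<open>E\<close> matter.
\<close>

definition is_sup_in :: "'a::order set \<Rightarrow> 'a set \<Rightarrow> 'a \<Rightarrow> bool" where
  "is_sup_in V A s \<longleftrightarrow> s \<in> V \<and> (\<forall>a\<in>A. a \<le> s) \<and> (\<forall>u\<in>V. (\<forall>a\<in>A. a \<le> u) \<longrightarrow> s \<le> u)"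

definition is_inf_in :: "'a::order set \<Rightarrow> 'a set \<Rightarrow> 'a \<Rightarrow> bool" where
  "is_inf_in V A s \<longleftrightarrow> s \<in> V \<and> (\<forall>a\<in>A. s \<le> a) \<and> (\<forall>u\<in>V. (\<forall>a\<in>A. u \<le> a) \<longrightarrow> u \<le> s)"

definition up_directed :: "'a::order set \<Rightarrow> bool" where
  "up_directed A \<longleftrightarrow> A \<noteq> {} \<and> (\<forall>a\<in>A. \<forall>b\<in>A. \<exists>c\<in>A. a \<le> c \<and> b \<le> c)"

definition down_directed :: "'a::order set \<Rightarrow> bool" where
  "down_directed A \<longleftrightarrow> A \<noteq> {} \<and> (\<forall>a\<in>A. \<forall>b\<in>A. \<exists>c\<in>A. c \<le> a \<and> c \<le> b)"

definition dedekind_complete_in :: "'a::order set \<Rightarrow> bool" where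
  "dedekind_complete_in V \<longleftrightarrow>
     (\<forall>A. A \<subseteq> V \<longrightarrow> A \<noteq> {} \<longrightarrow> (\<exists>u\<in>V. \<forall>a\<in>A. a \<le> u) \<longrightarrow> (\<exists>s. is_sup_in V A s))"

text \<open>
  Order convergence of the net \<open>f\<close> to \<open>x\<close>: there is a net decreasing to \<open>0\<close>, here the downward
  directed set \<open>Y\<close>, each member of which eventually dominates \<open>\<bar>f i - x\<bar>\<close>.  The filter \<open>F\<close>
  plays the role of the directed index set.
\<close>

definition order_tendsto_in ::
  "'a::riesz_space set \<Rightarrow> ('i \<Rightarrow> 'a) \<Rightarrow> 'a \<Rightarrow> 'i filter \<Rightarrow> bool" where
  "order_tendsto_in V f x F \<longleftrightarrow>
     (\<exists>Y. Y \<subseteq> V \<and> down_directed Y \<and> is_inf_in V Y 0 \<and>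
          (\<forall>y\<in>Y. \<forall>\<^sub>F i in F. \<bar>f i - x\<bar> \<le> y))"

abbreviation order_tendsto :: "('i \<Rightarrow> 'a::riesz_space) \<Rightarrow> 'a \<Rightarrow> 'i filter \<Rightarrow> bool" where
  "order_tendsto \<equiv> order_tendsto_in UNIV"

text \<open>
  It suffices to quantify over filters on the space itself: order convergence of a net and of its
  image depend only on the filter generated by the tails of the net.
\<close>

definition order_continuous_on :: "'a::riesz_space set \<Rightarrow> ('a \<Rightarrow> 'a) \<Rightarrow> bool" where
  "order_continuous_on E U \<longleftrightarrow>
     (\<forall>F. \<forall>x\<in>E. (\<forall>\<^sub>F y in F. y \<in> E) \<longrightarrow>
        order_tendsto_in E (\<lambda>y. y) x F \<longrightarrow> order_tendsto_in E U (U x) F)"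

definition linear_operator_on :: "'a::real_vector set \<Rightarrow> ('a \<Rightarrow> 'a) \<Rightarrow> bool" where
  "linear_operator_on E U \<longleftrightarrow>
     U ` E \<subseteq> E \<and> (\<forall>x\<in>E. \<forall>y\<in>E. U (x + y) = U x + U y) \<and> (\<forall>c. \<forall>x\<in>E. U (c *\<^sub>R x) = c *\<^sub>R U x)"

definition riesz_homomorphism_on :: "'a::riesz_space set \<Rightarrow> ('a \<Rightarrow> 'a) \<Rightarrow> bool" where
  "riesz_homomorphism_on E U \<longleftrightarrow>
     linear_operator_on E U \<and>
     (\<forall>x\<in>E. \<forall>y\<in>E. U (sup x y) = sup (U x) (U y) \<and> U (inf x y) = inf (U x) (U y))"

definition riesz_subspace :: "'a::riesz_space set \<Rightarrow> bool" where
  "riesz_subspace E \<longleftrightarrow> subspace E \<and> (\<forall>x\<in>E. \<forall>y\<in>E. sup x y \<in> E \<and> inf x y \<in> E)"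

definition order_dense :: "'a::riesz_space set \<Rightarrow> bool" where
  "order_dense E \<longleftrightarrow> (\<forall>x>0. \<exists>y\<in>E. 0 < y \<and> y \<le> x)"

definition weak_order_unit :: "'a::riesz_space set \<Rightarrow> 'a \<Rightarrow> bool" where
  "weak_order_unit E e \<longleftrightarrow> e \<in> E \<and> 0 \<le> e \<and> (\<forall>x\<in>E. inf \<bar>x\<bar> e = 0 \<longrightarrow> x = 0)"


section \<open>Conditional expectation preserving systems\<close>

locale conditional_riesz_triple =
  fixes E :: "'a::riesz_space set" and e :: 'a and T :: "'a \<Rightarrow> 'a"
  assumes riesz_subspace: "riesz_subspace E"
    and dedekind_complete: "dedekind_complete_in E"
    and weak_order_unit: "weak_order_unit E e"
    and T_linear: "linear_operator_on E T"
    and T_projection: "\<And>x. x \<in> E \<Longrightarrow> T (T x) = T x"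
    and T_strictly_positive: "\<And>x. x \<in> E \<Longrightarrow> 0 < x \<Longrightarrow> 0 < T x"
    and T_order_continuous: "order_continuous_on E T"
    and T_unit: "T e = e"
    and T_range: "dedekind_complete_in (T ` E)"

locale conditional_expectation_preserving_system = conditional_riesz_triple E e T
  for E :: "'a::riesz_space set" and T S :: "'a \<Rightarrow> 'a" and e :: 'a +
  assumes S_homomorphism: "riesz_homomorphism_on E S"
    and S_order_continuous: "order_continuous_on E S"
    and S_unit: "S e = e"
    and T_S: "\<And>f. f \<in> E \<Longrightarrow> T (S f) = T f"

definition ergodic :: "'a set \<Rightarrow> ('a \<Rightarrow> 'a) \<Rightarrow> ('a \<Rightarrow> 'a) \<Rightarrow> bool" where
  "ergodic E T S \<longleftrightarrow> (\<forall>f\<in>E. S f = f \<longrightarrow> T f = f)"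

definition components_of :: "'a::riesz_space set \<Rightarrow> 'a \<Rightarrow> 'a set" where
  "components_of E e = {p \<in> E. inf p (e - p) = 0}"

definition principal_ideal :: "'a::riesz_space set \<Rightarrow> 'a \<Rightarrow> 'a set" where
  "principal_ideal E e = {f \<in> E. \<exists>M\<ge>0. \<bar>f\<bar> \<le> M *\<^sub>R e}"


section \<open>The natural domain and the extended operators\<close>

text \<open>
  \<open>E\<close> sits as an order dense Riesz subspace in the type, which is its universal completion.
  \<open>approximating E T A x\<close> says that \<open>A\<close> is (the range of) an increasing net in the positive cone
  of \<open>E\<close> with supremum \<open>x\<close> in the universal completion whose image under \<open>T\<close> is order bounded
  there; the image consists of positive elements, so only upper bounds matter.
\<close>

definition approximating ::
  "'a::universally_complete_f_algebra set \<Rightarrow> ('a \<Rightarrow> 'a) \<Rightarrow> 'a set \<Rightarrow> 'a \<Rightarrow> bool" where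
  "approximating E T A x \<longleftrightarrow>
     A \<subseteq> E \<and> (\<forall>a\<in>A. 0 \<le> a) \<and> up_directed A \<and> is_sup_in UNIV A x \<and> bdd_above (T ` A)"

definition natural_domain_pos ::
  "'a::universally_complete_f_algebra set \<Rightarrow> ('a \<Rightarrow> 'a) \<Rightarrow> 'a set" where
  "natural_domain_pos E T = {x. 0 \<le> x \<and> (\<exists>A. approximating E T A x)}"

definition L1 :: "'a::universally_complete_f_algebra set \<Rightarrow> ('a \<Rightarrow> 'a) \<Rightarrow> 'a set" where
  "L1 E T = {x - y | x y. x \<in> natural_domain_pos E T \<and> y \<in> natural_domain_pos E T}"

text \<open>
  The extension to \<open>L1 E T\<close> of an operator \<open>U\<close> on \<open>E\<close>, used for \<open>U = T\<close> and \<open>U = S\<close>: on the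
  positive part it is the supremum of \<open>U\<close> along an approximating net, and it is continued
  linearly to differences.  The value does not depend on the nets or on the representation
  as a difference.
\<close>

definition extend ::
  "'a::universally_complete_f_algebra set \<Rightarrow> ('a \<Rightarrow> 'a) \<Rightarrow> ('a \<Rightarrow> 'a) \<Rightarrow> 'a \<Rightarrow> 'a" where
  "extend E T U z =
     (THE t. \<exists>x y A B. z = x - y \<and> approximating E T A x \<and> approximating E T B y \<and>
                       t = (SUP a\<in>A. U a) - (SUP b\<in>B. U b))"

definition Linf :: "'a::universally_complete_f_algebra set \<Rightarrow> ('a \<Rightarrow> 'a) \<Rightarrow> 'a set" where
  "Linf E T = {f \<in> L1 E T. \<exists>u \<in> extend E T T ` L1 E T. \<bar>f\<bar> \<le> u}"

definition averages_converge ::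
  "'a::universally_complete_f_algebra set \<Rightarrow> ('a \<Rightarrow> 'a) \<Rightarrow> ('a \<Rightarrow> 'a) \<Rightarrow> 'a \<Rightarrow> 'a \<Rightarrow> bool" where
  "averages_converge E T S f g \<longleftrightarrow>
     order_tendsto
       (\<lambda>n. (1 / real n) *\<^sub>R (\<Sum>k<n. extend E T T (f * (extend E T S ^^ k) g)))
       (extend E T T f * extend E T T g) sequentially"

end

theory Submission
  imports Defs
begin

text \<open>
  For an ergodic system and bounded \<open>g\<close>, the averages \<open>A\<^sub>n g\<close> of \<open>g, S g, S\<^sup>2 g, \<dots>\<close> converge in order
  to \<open>T g\<close>: their upper limit \<open>h\<close> is \<open>S\<close>-invariant, hence fixed by \<open>T\<close>, and a maximal inequality
  applied to \<open>g - h + \<epsilon> e\<close> gives \<open>h \<le> T g\<close>; the lower limit is treated by passing to \<open>- g\<close>.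
  Applying the order continuous \<open>T\<close> to \<open>f (A\<^sub>n g - T g)\<close> yields mixing in the mean for bounded \<open>f\<close>
  and \<open>g\<close>, and truncation by multiples of \<open>e\<close> extends it to \<open>L\<^sup>\<infinity>\<close> and \<open>L\<^sup>1\<close>.

  Conversely, mixing for an invariant component \<open>p\<close> says \<open>T p = (T p)\<^sup>2\<close>, so \<open>T (p - T p)\<^sup>2 = 0\<close> and
  \<open>T p = p\<close>.  For a bounded invariant \<open>f\<close> take \<open>p\<close> to be the carrier of \<open>(f - T f)\<^sup>+\<close>: then
  \<open>T (f - T f)\<^sup>+ = T (p (f - T f)) = p T (f - T f) = 0\<close>, so \<open>f \<le> T f\<close>, which forces \<open>f = T f\<close>.

  The averaging property \<open>T (v x) = v T x\<close> for \<open>v\<close> in the range comes from the Schwarz inequality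
  \<open>(T x)\<^sup>2 \<le> T (x\<^sup>2)\<close>, which needs no spectral theory: it follows from
  \<open>0 \<le> T ((x - r e)\<^sup>2)\<close> for all real \<open>r\<close>.
\<close>

section \<open>Riesz spaces\<close>

lemma inf_diff_right: "inf a b - c = inf (a - c) (b - (c::'a::riesz_space))"
  unfolding diff_conv_add_uminus by (rule add_inf_distrib_right)

lemma diff_inf_eq_pos: "x - inf x y = sup (x - y) (0::'a::riesz_space)"
  using add_sup_distrib_left[of x "- x" "- y"] by (simp add: diff_inf_eq_sup sup_commute)

lemma pos_diff_neg: "sup x 0 - sup (- x) 0 = (x::'a::riesz_space)"
  using diff_inf_eq_pos[of x 0]
  unfolding inf_eq_neg_sup[of x 0] minus_zero diff_0_right diff_minus_eq_add
  by (metis add_diff_cancel)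

lemma inf_pos_neg: "inf (sup x 0) (sup (- x) 0) = (0::'a::riesz_space)"
proof -
  have "inf (sup x 0) (sup (- x) 0) - sup (- x) 0 = inf x 0"
    unfolding inf_diff_right pos_diff_neg by simp
  also have "inf x 0 = - sup (- x) 0"
    using inf_eq_neg_sup[of x 0] by simp
  finally have "inf (sup x 0) (sup (- x) 0) - sup (- x) 0 = 0 - sup (- x) 0" by simp
  then show ?thesis by (simp only: diff_right_commute right_minus_eq diff_eq_eq diff_add_cancel)
qed

lemma pos_add_neg: "sup x 0 + sup (- x) 0 = \<bar>x::'a::riesz_space\<bar>"
  using inf_eq_neg_sup[of x 0] by (simp add: abs_prts pprt_def nprt_def)

lemma pos_le_abs: "sup x 0 \<le> \<bar>x::'a::riesz_space\<bar>" "sup (- x) 0 \<le> \<bar>x\<bar>"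
  by (auto simp: abs_ge_minus_self abs_ge_self)

lemma scaleR_pos_le_iff: "0 < r \<Longrightarrow> r *\<^sub>R x \<le> r *\<^sub>R y \<longleftrightarrow> x \<le> (y::'a::riesz_space)"
  using scaleR_left_mono[of x y r] scaleR_left_mono[of "r *\<^sub>R x" "r *\<^sub>R y" "inverse r"] by auto

lemma scaleR_inf:
  fixes x y :: "'a::riesz_space"
  assumes "0 \<le> r" shows "r *\<^sub>R inf x y = inf (r *\<^sub>R x) (r *\<^sub>R y)"
proof (cases "r = 0")
  case False
  with assms have r: "0 < r" by simp
  show ?thesis
  proof (rule antisym)
    show "r *\<^sub>R inf x y \<le> inf (r *\<^sub>R x) (r *\<^sub>R y)"
      using assms by (auto intro: scaleR_left_mono)
    have "inverse r *\<^sub>R inf (r *\<^sub>R x) (r *\<^sub>R y) \<le> inf x y"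
      using scaleR_left_mono[of "inf (r *\<^sub>R x) (r *\<^sub>R y)" "r *\<^sub>R x" "inverse r"]
        scaleR_left_mono[of "inf (r *\<^sub>R x) (r *\<^sub>R y)" "r *\<^sub>R y" "inverse r"] r by auto
    from scaleR_left_mono[OF this assms] show "inf (r *\<^sub>R x) (r *\<^sub>R y) \<le> r *\<^sub>R inf x y"
      using r by simp
  qed
qed simp

lemma scaleR_sup:
  fixes x y :: "'a::riesz_space"
  assumes "0 \<le> r" shows "r *\<^sub>R sup x y = sup (r *\<^sub>R x) (r *\<^sub>R y)"
  using scaleR_inf[OF assms, of "-x" "-y"]
  by (simp only: sup_eq_neg_inf[of x] sup_eq_neg_inf[of "r *\<^sub>R x"] scaleR_minus_right)

lemma abs_scaleR:
  fixes x :: "'a::riesz_space"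
  shows "\<bar>r *\<^sub>R x\<bar> = \<bar>r\<bar> *\<^sub>R \<bar>x\<bar>"
proof (cases "0 \<le> r")
  case True
  then show ?thesis using scaleR_sup[OF True, of x "- x"] by (simp only: abs_lattice[of x] abs_lattice[of "r *\<^sub>R x"] abs_of_nonneg scaleR_minus_right)
next
  case False
  then have "(- r) *\<^sub>R \<bar>x\<bar> = \<bar>(- r) *\<^sub>R x\<bar>"
    using scaleR_sup[of "- r" x "- x"]
    by (simp only: abs_lattice[of x] abs_lattice[of "- r *\<^sub>R x"] scaleR_minus_right)
  with False show ?thesis by simp
qed

text \<open>Since \<open>b\<close> is positive, enlarging \<open>c\<close> to \<open>c + b\<close>
  only raises the meet, and translation evaluates \<open>inf (a + b) (c + b)\<close> as
  \<open>b\<close>; what remains is at most \<open>inf b c\<close>.\<close>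

lemma disjoint_add:
  fixes a b c :: "'a::riesz_space"
  assumes "inf a c = 0" "inf b c = 0"
  shows "inf (a + b) c = 0"
proof -
  have nn: "0 \<le> a" "0 \<le> b" "0 \<le> c" using assms by (metis inf.cobounded1 inf.cobounded2)+
  have "inf (a + b) c \<le> inf (a + b) (c + b)"
    using nn by (auto intro: le_infI1 le_infI2 add_increasing2)
  also have "\<dots> = b" using assms(1) add_inf_distrib_right[of a c b] by simp
  finally have "inf (a + b) c \<le> inf b c" by simp
  then show ?thesis using assms nn by (intro antisym) auto
qed

lemma disjoint_sum:
  fixes a :: "'i \<Rightarrow> 'a::riesz_space"
  assumes "finite I" "\<And>i. i \<in> I \<Longrightarrow> inf (a i) c = 0" "0 \<le> c"
  shows "inf (sum a I) c = 0"
  using assms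
proof (induction I rule: finite_induct)
  case empty
  then show ?case by (simp add: inf_absorb1)
next
  case (insert i I)
  then show ?case by (simp add: disjoint_add)
qed

lemma disjoint_mono:
  fixes a b c d :: "'a::riesz_space"
  assumes "inf b d = 0" "0 \<le> a" "a \<le> b" "0 \<le> c" "c \<le> d"
  shows "inf a c = 0"
  by (metis assms inf_mono inf_greatest antisym)

lemma disjoint_scaleR:
  fixes a b :: "'a::riesz_space"
  assumes "inf a b = 0" "0 \<le> r" "0 \<le> s"
  shows "inf (r *\<^sub>R a) (s *\<^sub>R b) = 0"
proof -
  have nn: "0 \<le> a" "0 \<le> b" using assms by (metis inf.cobounded1 inf.cobounded2)+
  define t where "t = max r s"
  have t: "0 \<le> t" "r \<le> t" "s \<le> t" using assms by (auto simp: t_def)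
  have "inf (t *\<^sub>R a) (t *\<^sub>R b) = 0"
    using scaleR_inf[of t a b] t assms by simp
  then show ?thesis
    by (rule disjoint_mono) (use nn t assms in \<open>auto intro: scaleR_right_mono scaleR_nonneg_nonneg\<close>)
qed

text \<open>A sum of pairwise disjoint positive elements is their supremum, so a common upper bound
  of the terms bounds all partial sums.\<close>

lemma disjoint_sum_le:
  fixes a :: "nat \<Rightarrow> 'a::riesz_space"
  assumes "\<And>m n. m \<noteq> n \<Longrightarrow> inf (a m) (a n) = 0" "\<And>n. 0 \<le> a n" "\<And>n. a n \<le> z" "0 \<le> z"
  shows "(\<Sum>n<N. a n) \<le> z"
proof (induction N)
  case (Suc N)
  have "inf (\<Sum>n<N. a n) (a N) = 0"
    by (rule disjoint_sum) (use assms in auto)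
  then have "(\<Sum>n<N. a n) + a N = sup (\<Sum>n<N. a n) (a N)"
    using add_eq_inf_sup[of "\<Sum>n<N. a n" "a N"] by simp
  then show ?case using Suc assms(3) by simp
qed (simp add: assms)

text \<open>The identity \<open>c + s = inf c s + sup c s\<close> turns the claim into the upper
  bound \<open>sup c s - c\<close> for \<open>s\<close>, which only has to be checked on the members
  of \<open>X\<close>.\<close>

lemma inf_disjoint_Sup_le:
  fixes c s :: "'a::riesz_space"
  assumes "\<And>x. x \<in> X \<Longrightarrow> inf c x \<le> 0" "\<And>u. (\<And>x. x \<in> X \<Longrightarrow> x \<le> u) \<Longrightarrow> s \<le> u"
    "\<And>x. x \<in> X \<Longrightarrow> x \<le> s"
  shows "inf c s \<le> 0"
proof -
  have "s \<le> sup c s - c"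
  proof (rule assms(2))
    fix x assume x: "x \<in> X"
    have "c + x = inf c x + sup c x" by (metis add_eq_inf_sup add.commute)
    also have "\<dots> \<le> 0 + sup c s"
      by (intro add_mono assms sup_mono x) simp
    finally show "x \<le> sup c s - c" by (simp add: algebra_simps)
  qed
  then have "c + s \<le> sup c s" by (simp add: algebra_simps)
  then show ?thesis by (simp add: add_eq_inf_sup[of c s])
qed

section \<open>Sequences decreasing to zero\<close>

definition null_seq :: "(nat \<Rightarrow> 'a::riesz_space) \<Rightarrow> bool" where
  "null_seq X \<longleftrightarrow> antimono X \<and> (\<forall>n. 0 \<le> X n) \<and> (\<forall>c. (\<forall>n. c \<le> X n) \<longrightarrow> c \<le> 0)"

lemma null_seqI:
  assumes "\<And>n. X (Suc n) \<le> X n" "\<And>n. 0 \<le> X n" "\<And>c. (\<And>n. c \<le> X n) \<Longrightarrow> c \<le> 0"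
  shows "null_seq X"
  using assms by (auto simp: null_seq_def decseq_Suc_iff)

lemma null_seq_nonneg: "null_seq X \<Longrightarrow> 0 \<le> X n"
  and null_seq_antimono: "null_seq X \<Longrightarrow> m \<le> n \<Longrightarrow> X n \<le> X m"
  by (auto simp: null_seq_def antimono_def)

lemma null_seqD: "null_seq X \<Longrightarrow> (\<And>n. c \<le> X n) \<Longrightarrow> c \<le> 0"
  by (auto simp: null_seq_def)

lemma null_seq_add:
  assumes X: "null_seq X" and Y: "null_seq Y"
  shows "null_seq (\<lambda>n. X n + Y n)"
proof (rule null_seqI)
  fix c assume c: "\<And>n. c \<le> X n + Y n"
  \<comment> \<open>With \<open>m\<close> fixed only the second index moves; \<open>max m n\<close>
    compares both sequences at a common index.\<close>
  have "c - X m \<le> 0" for m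
  proof (rule null_seqD[OF Y])
    fix n
    have "c \<le> X (max m n) + Y (max m n)" by (rule c)
    also have "\<dots> \<le> X m + Y n"
      by (intro add_mono null_seq_antimono X Y) auto
    finally show "c - X m \<le> Y n" by (simp add: algebra_simps)
  qed
  then show "c \<le> 0" by (intro null_seqD[OF X]) simp
qed (auto intro!: add_mono add_nonneg_nonneg null_seq_antimono[OF X] null_seq_antimono[OF Y]
    null_seq_nonneg[OF X] null_seq_nonneg[OF Y])

lemma null_seq_le:
  assumes X: "null_seq X" and "\<And>n. Y (Suc n) \<le> Y n" "\<And>n. 0 \<le> Y n" "\<And>n. Y n \<le> X n"
  shows "null_seq Y"
  by (rule null_seqI) (use assms in \<open>blast intro: null_seqD[OF X] order_trans\<close>)+

lemma null_seq_scaleR: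
  assumes X: "null_seq X" and "0 \<le> r"
  shows "null_seq (\<lambda>n. r *\<^sub>R X n)"
proof (cases "r = 0")
  case False
  with assms have r: "0 < r" by simp
  show ?thesis
  proof (rule null_seqI)
    fix c assume c: "\<And>n. c \<le> r *\<^sub>R X n"
    have "inverse r *\<^sub>R c \<le> 0"
    proof (rule null_seqD[OF X])
      fix n show "inverse r *\<^sub>R c \<le> X n"
        using scaleR_left_mono[OF c[of n], of "inverse r"] r by simp
    qed
    then show "c \<le> 0" using scaleR_pos_le_iff[of "inverse r" c 0] r by simp
  qed (use assms in \<open>auto intro!: scaleR_left_mono scaleR_nonneg_nonneg null_seq_antimono[OF X] null_seq_nonneg[OF X]\<close>)
qed (auto intro: null_seqI)

section \<open>Order convergence\<close>

text \<open>The eventual bounds of the error are closed under \<open>inf\<close>, so they themselves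
  form the dominating directed set. It remains to have one such bound and to know that the lower
  bounds of all of them are at most 0.\<close>

lemma order_tendstoI:
  fixes f :: "nat \<Rightarrow> 'a::riesz_space"
  assumes "\<forall>\<^sub>F n in sequentially. \<bar>f n - x\<bar> \<le> y0"
    and "\<And>c. (\<And>y. (\<forall>\<^sub>F n in sequentially. \<bar>f n - x\<bar> \<le> y) \<Longrightarrow> c \<le> y) \<Longrightarrow> c \<le> 0"
  shows "order_tendsto f x sequentially"
  unfolding order_tendsto_in_def
proof (intro exI conjI ballI)
  let ?Y = "{y. \<forall>\<^sub>F n in sequentially. \<bar>f n - x\<bar> \<le> y}"
  show "down_directed ?Y" unfolding down_directed_def
  proof (intro conjI ballI)
    show "?Y \<noteq> {}" using assms(1) by auto
    fix a b assume "a \<in> ?Y" "b \<in> ?Y"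
    then have "\<forall>\<^sub>F n in sequentially. \<bar>f n - x\<bar> \<le> inf a b"
      using eventually_conj by (simp add: eventually_conj_iff)
    then have "inf a b \<in> ?Y" by simp
    then show "\<exists>c\<in>?Y. c \<le> a \<and> c \<le> b" by (rule bexI[rotated]) auto
  qed
  have "0 \<le> y" if "y \<in> ?Y" for y
  proof -
    from that have "\<exists>n. \<bar>f n - x\<bar> \<le> y"
      by (intro eventually_happens'[OF sequentially_bot]) simp
    then show ?thesis by (meson abs_ge_zero order_trans)
  qed
  moreover have "u \<le> 0" if "\<forall>y\<in>?Y. u \<le> y" for u
    by (rule assms(2)) (use that in simp)
  ultimately show "is_inf_in UNIV ?Y 0" unfolding is_inf_in_def by simp
qed auto

lemma order_tendstoD:
  fixes f :: "nat \<Rightarrow> 'a::riesz_space"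
  assumes "order_tendsto f x sequentially"
  shows "\<exists>y. \<forall>\<^sub>F n in sequentially. \<bar>f n - x\<bar> \<le> y"
    and "(\<And>y. (\<forall>\<^sub>F n in sequentially. \<bar>f n - x\<bar> \<le> y) \<Longrightarrow> c \<le> y) \<Longrightarrow> c \<le> 0"
proof -
  obtain Y where Y: "Y \<noteq> {}" "\<And>u. (\<forall>y\<in>Y. u \<le> y) \<Longrightarrow> u \<le> 0"
    "\<And>y. y \<in> Y \<Longrightarrow> \<forall>\<^sub>F n in sequentially. \<bar>f n - x\<bar> \<le> y"
    using assms unfolding order_tendsto_in_def down_directed_def is_inf_in_def ball_UNIV by metis
  then show "\<exists>y. \<forall>\<^sub>F n in sequentially. \<bar>f n - x\<bar> \<le> y" by blast
  show "c \<le> 0" if "\<And>y. (\<forall>\<^sub>F n in sequentially. \<bar>f n - x\<bar> \<le> y) \<Longrightarrow> c \<le> y"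
    using Y(2,3) that by simp
qed

lemma order_tendsto_const_unique:
  fixes a b :: "'a::riesz_space"
  assumes "order_tendsto f b sequentially" "\<forall>\<^sub>F n in sequentially. f n = a"
  shows "a = b"
proof -
  have "\<bar>a - b\<bar> \<le> 0"
  proof (rule order_tendstoD(2)[OF assms(1)])
    fix y assume "\<forall>\<^sub>F n in sequentially. \<bar>f n - b\<bar> \<le> y"
    with assms(2) have "\<forall>\<^sub>F n::nat in sequentially. \<bar>a - b\<bar> \<le> y"
      by eventually_elim simp
    then show "\<bar>a - b\<bar> \<le> y" by simp
  qed
  then show ?thesis by simp
qed

lemma order_tendsto_add:
  fixes f g :: "nat \<Rightarrow> 'a::riesz_space"
  assumes f: "order_tendsto f x sequentially" and g: "order_tendsto g y sequentially"
  shows "order_tendsto (\<lambda>n. f n + g n) (x + y) sequentially"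
proof -
  have ev: "\<forall>\<^sub>F n in sequentially. \<bar>f n + g n - (x + y)\<bar> \<le> a + b"
    if "\<forall>\<^sub>F n in sequentially. \<bar>f n - x\<bar> \<le> a" "\<forall>\<^sub>F n in sequentially. \<bar>g n - y\<bar> \<le> b" for a b
    using that
  proof eventually_elim
    fix n assume *: "\<bar>f n - x\<bar> \<le> a" "\<bar>g n - y\<bar> \<le> b"
    have "f n + g n - (x + y) = (f n - x) + (g n - y)" by simp
    then have "\<bar>f n + g n - (x + y)\<bar> \<le> \<bar>f n - x\<bar> + \<bar>g n - y\<bar>"
      by (metis abs_triangle_ineq)
    with * show "\<bar>f n + g n - (x + y)\<bar> \<le> a + b" by (meson add_mono order_trans)
  qed
  obtain a0 b0 where 0: "\<forall>\<^sub>F n in sequentially. \<bar>f n - x\<bar> \<le> a0" "\<forall>\<^sub>F n in sequentially. \<bar>g n - y\<bar> \<le> b0"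
    using order_tendstoD(1)[OF f] order_tendstoD(1)[OF g] by blast
  show ?thesis
  proof (rule order_tendstoI[OF ev[OF 0]])
    fix c assume c: "\<And>z. \<forall>\<^sub>F n in sequentially. \<bar>f n + g n - (x + y)\<bar> \<le> z \<Longrightarrow> c \<le> z"
    have "c - b \<le> 0" if b: "\<forall>\<^sub>F n in sequentially. \<bar>g n - y\<bar> \<le> b" for b
    proof (rule order_tendstoD(2)[OF f])
      fix a assume "\<forall>\<^sub>F n in sequentially. \<bar>f n - x\<bar> \<le> a"
      from c[OF ev[OF this b]] show "c - b \<le> a" by (simp add: algebra_simps)
    qed
    then show "c \<le> 0" by (intro order_tendstoD(2)[OF g]) simp
  qed
qed

lemma order_tendsto_uminus:
  fixes f :: "nat \<Rightarrow> 'a::riesz_space"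
  assumes "order_tendsto f x sequentially"
  shows "order_tendsto (\<lambda>n. - f n) (- x) sequentially"
proof -
  have "\<bar>- f n - - x\<bar> = \<bar>f n - x\<bar>" for n
    by (metis abs_minus_commute minus_diff_eq minus_diff_minus)
  with assms show ?thesis unfolding order_tendsto_in_def by simp
qed

lemma order_tendsto_diff:
  fixes f g :: "nat \<Rightarrow> 'a::riesz_space"
  assumes "order_tendsto f x sequentially" "order_tendsto g y sequentially"
  shows "order_tendsto (\<lambda>n. f n - g n) (x - y) sequentially"
  using order_tendsto_add[OF assms(1) order_tendsto_uminus[OF assms(2)]] by simp

section \<open>Dedekind complete Riesz spaces and f-algebras\<close>

text \<open>Dedekind completeness gives the multiples of \<open>x\<close> a supremum; shifting the
  index by one shows that it remains an upper bound after \<open>x\<close> is subtracted.\<close>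

lemma archimedean:
  fixes x y :: "'a::universally_complete_f_algebra"
  assumes "\<And>n. real (Suc n) *\<^sub>R x \<le> y"
  shows "x \<le> 0"
proof -
  let ?s = "SUP n. real (Suc n) *\<^sub>R x"
  have bdd: "bdd_above (range (\<lambda>n. real (Suc n) *\<^sub>R x))"
    using assms by (intro bdd_aboveI[of _ y]) auto
  have "?s \<le> ?s - x"
  proof (rule cSUP_least)
    fix n :: nat
    have "real (Suc (Suc n)) *\<^sub>R x \<le> ?s" by (rule cSUP_upper[OF _ bdd]) simp
    moreover have "real (Suc (Suc n)) *\<^sub>R x = real (Suc n) *\<^sub>R x + x"
      using scaleR_add_left[of "real (Suc n)" 1 x] by (simp add: add.commute)
    ultimately show "real (Suc n) *\<^sub>R x \<le> ?s - x" by (simp add: algebra_simps)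
  qed simp
  then have "?s + x \<le> ?s" by (simp only: le_diff_eq)
  then show ?thesis by simp
qed

lemma archimedean_inverse:
  fixes x y :: "'a::universally_complete_f_algebra"
  assumes "\<And>n. x \<le> (1 / real (Suc n)) *\<^sub>R y"
  shows "x \<le> 0"
proof (rule archimedean)
  fix n
  show "real (Suc n) *\<^sub>R x \<le> y"
    using scaleR_left_mono[OF assms[of n], of "real (Suc n)"] by simp
qed

lemma null_seq_inverse:
  fixes y :: "'a::universally_complete_f_algebra"
  assumes "0 \<le> y"
  shows "null_seq (\<lambda>n. (1 / real (Suc n)) *\<^sub>R y)"
proof (rule null_seqI)
  fix c assume "\<And>n. c \<le> (1 / real (Suc n)) *\<^sub>R y"
  then show "c \<le> 0" by (rule archimedean_inverse)
qed (use assms in \<open>auto intro!: scaleR_right_mono scaleR_nonneg_nonneg simp: frac_le\<close>)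

text \<open>Multiplying one of two disjoint elements by a positive one keeps them disjoint; doing so
  on both sides makes \<open>x * y\<close> disjoint from itself.\<close>

lemma disjoint_mult_eq_0:
  fixes x y :: "'a::universally_complete_f_algebra"
  assumes "inf x y = 0" shows "x * y = 0"
proof -
  have nn: "0 \<le> x" "0 \<le> y" using assms by (metis inf.cobounded1 inf.cobounded2)+
  have "inf (y * x) y = 0" using f_algebra[OF assms nn(2)] .
  then have "inf y (y * x) = 0" by (simp add: inf_commute)
  from f_algebra[OF this nn(1)] show ?thesis by (simp add: mult.commute)
qed

lemma square_diff_disjoint:
  fixes p n :: "'a::universally_complete_f_algebra"
  assumes "inf p n = 0"
  shows "(p - n) * (p - n) = p * p + n * n" "(p + n) * (p + n) = p * p + n * n"
  using disjoint_mult_eq_0[OF assms] by (auto simp: algebra_simps)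

lemma square_nonneg: "0 \<le> (x::'a::universally_complete_f_algebra) * x"
proof -
  have "0 \<le> sup x 0 * sup x 0 + sup (- x) 0 * sup (- x) 0"
    by (intro add_nonneg_nonneg mult_nonneg_nonneg) auto
  then show ?thesis
    unfolding square_diff_disjoint(1)[OF inf_pos_neg, symmetric] pos_diff_neg .
qed

lemma abs_square: "\<bar>x\<bar> * \<bar>x\<bar> = (x::'a::universally_complete_f_algebra) * x"
  using square_diff_disjoint[OF inf_pos_neg, of x] unfolding pos_diff_neg pos_add_neg by simp

text \<open>Subtracting the meet \<open>m\<close> leaves disjoint remainders \<open>a'\<close> and
  \<open>b'\<close>. The squares exceed \<open>m * m\<close> by positive multiples of these
  remainders, which are again disjoint, so the meet of the squares is \<open>m * m\<close>.\<close>

lemma inf_squares: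
  fixes a b :: "'a::universally_complete_f_algebra"
  assumes "0 \<le> a" "0 \<le> b"
  shows "inf (a * a) (b * b) \<le> inf a b * inf a b"
proof -
  define m a' b' where "m = inf a b" and "a' = a - m" and "b' = b - m"
  have "m \<le> a" "m \<le> b" by (auto simp: m_def)
  then have nn: "0 \<le> a'" "0 \<le> b'" by (auto simp: a'_def b'_def)
  have "0 \<le> m" using assms by (simp add: m_def)
  note nn = this nn
  have dis: "inf a' b' = 0"
    using inf_diff_right[of a b m] by (simp add: a'_def b'_def m_def)
  have "inf ((m + m + a') * a') b' = 0"
    by (rule f_algebra[OF dis]) (use nn in auto)
  then have "inf b' ((m + m + a') * a') = 0" by (simp add: inf_commute)
  from f_algebra[OF this, of "m + m + b'"] nn
  have z: "inf ((m + m + a') * a') ((m + m + b') * b') = 0" by (simp add: inf_commute)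
  have "a * a = (m + m + a') * a' + m * m" "b * b = (m + m + b') * b' + m * m"
    by (simp_all add: a'_def b'_def algebra_simps)
  then have "inf (a * a) (b * b) = m * m"
    using z add_inf_distrib_right[of "(m + m + a') * a'" "(m + m + b') * b'" "m * m"] by simp
  then show ?thesis by (simp add: m_def)
qed

section \<open>Order dense subspaces and positive operators\<close>

text \<open>Free of \<open>T\<close> and \<open>S\<close>, so that the ideal property, truncation
  and the estimates for products serve both operators.\<close>

locale dense_riesz_subspace =
  fixes E :: "'a::universally_complete_f_algebra set" and e :: 'a
  assumes riesz_subspace: "riesz_subspace E"
    and dedekind_complete: "dedekind_complete_in E"
    and order_dense: "order_dense E"
    and e_in_E: "e \<in> E" and e_nonneg: "0 \<le> e"
    and unit: "e * x = x"
begin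

lemma unit_right: "x * e = x"
  using unit[of x] by (simp add: mult.commute)

lemma E_zero: "0 \<in> E" and E_add: "x \<in> E \<Longrightarrow> y \<in> E \<Longrightarrow> x + y \<in> E"
  and E_scaleR: "x \<in> E \<Longrightarrow> r *\<^sub>R x \<in> E"
  and E_diff: "x \<in> E \<Longrightarrow> y \<in> E \<Longrightarrow> x - y \<in> E"
  and E_uminus: "x \<in> E \<Longrightarrow> - x \<in> E"
  and E_sum: "(\<And>i. i \<in> I \<Longrightarrow> f i \<in> E) \<Longrightarrow> sum f I \<in> E"
  using riesz_subspace unfolding riesz_subspace_def
  by (auto intro: subspace_0 subspace_add subspace_scale subspace_diff subspace_neg subspace_sum)

lemma E_sup: "x \<in> E \<Longrightarrow> y \<in> E \<Longrightarrow> sup x y \<in> E" and E_inf: "x \<in> E \<Longrightarrow> y \<in> E \<Longrightarrow> inf x y \<in> E"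
  using riesz_subspace unfolding riesz_subspace_def by auto

lemma E_abs: "x \<in> E \<Longrightarrow> \<bar>x\<bar> \<in> E"
  unfolding abs_lattice by (intro E_sup E_uminus)

lemma dense_below:
  assumes "\<not> x \<le> (0::'a)"
  obtains v where "v \<in> E" "0 < v" "v \<le> sup x 0"
proof -
  have "sup x 0 \<noteq> 0" using assms by (metis sup.cobounded1)
  then have "0 < sup x 0" by (metis order.not_eq_order_implies_strict sup.cobounded2)
  then show thesis using order_dense that unfolding order_dense_def by blast
qed

text \<open>The supremum \<open>s\<close>, formed in \<open>E\<close>, of the elements of
  \<open>E\<close> between 0 and \<open>y\<close> is \<open>y\<close> itself. If either inequality
  failed, order density would place some \<open>v > 0\<close> of \<open>E\<close> in the gap, and
  \<open>v\<close> could be added to every member of \<open>A\<close> without exceeding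
  \<open>s\<close>.\<close>

lemma E_ideal:
  assumes "x \<in> E" "0 \<le> y" "y \<le> x"
  shows "y \<in> E"
proof -
  define A where "A = {z \<in> E. 0 \<le> z \<and> z \<le> y}"
  have "A \<subseteq> E" "A \<noteq> {}" "\<exists>u\<in>E. \<forall>a\<in>A. a \<le> u"
    using assms E_zero by (auto simp: A_def intro!: bexI[of _ x])
  then obtain s where s: "is_sup_in E A s"
    using dedekind_complete unfolding dedekind_complete_in_def by meson
  then have sE: "s \<in> E" and s_up: "\<And>a. a \<in> A \<Longrightarrow> a \<le> s"
    and s_least: "\<And>u. u \<in> E \<Longrightarrow> (\<forall>a\<in>A. a \<le> u) \<Longrightarrow> s \<le> u"
    by (auto simp: is_sup_in_def)
  have s0: "0 \<le> s" using s_up[of 0] assms E_zero by (auto simp: A_def)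
  \<comment> \<open>Such a \<open>v\<close> would make \<open>s - v\<close> an upper bound of
    \<open>A\<close> in \<open>E\<close> that is smaller than the least one.\<close>
  have absurd: False if "v \<in> E" "0 < v" "\<And>a. a \<in> A \<Longrightarrow> a + v \<le> s" for v
  proof -
    have "s \<le> s - v"
      by (rule s_least) (use that sE E_diff in \<open>auto simp: le_diff_eq\<close>)
    then have "v \<le> 0" by simp
    with that(2) show False by (simp add: leD)
  qed
  have "y \<le> s"
  proof (rule ccontr)
    assume "\<not> y \<le> s"
    then have "\<not> y - s \<le> 0" by simp
    then obtain v where v: "v \<in> E" "0 < v" "v \<le> sup (y - s) 0"
      by (rule dense_below)
    show False
    proof (rule absurd[OF v(1,2)])
      fix a assume a: "a \<in> A"
      have "a + v \<le> a + sup (y - a) 0"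
        by (rule add_left_mono, rule order_trans[OF v(3)], rule sup_mono)
          (use s_up[OF a] in \<open>auto intro: diff_left_mono\<close>)
      also have "sup (y - a) 0 = y - a"
        using a by (intro sup_absorb1) (simp add: A_def)
      finally have "a + v \<le> y" by simp
      with a v have "a + v \<in> A" by (auto simp: A_def intro: E_add add_nonneg_nonneg)
      then show "a + v \<le> s" by (rule s_up)
    qed
  qed
  moreover have "s \<le> y"
  proof (rule ccontr)
    assume "\<not> s \<le> y"
    then have "\<not> s - y \<le> 0" by simp
    then obtain v where v: "v \<in> E" "0 < v" "v \<le> sup (s - y) 0"
      by (rule dense_below)
    show False
    proof (rule absurd[OF v(1,2)])
      fix a assume a: "a \<in> A"
      \<comment> \<open>Here \<open>a\<close> lies below both \<open>s\<close> and \<open>y\<close>,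
        and the gap \<open>s - inf s y\<close> has room for \<open>v\<close>.\<close>
      have "a + v \<le> (s - inf s y) + inf s y"
        unfolding diff_inf_eq_pos add.commute[of a] by (rule add_mono) (use a s_up[OF a] v(3) in \<open>auto simp: A_def\<close>)
      then show "a + v \<le> s" by (simp only: diff_add_cancel)
    qed
  qed
  ultimately have "y = s" by simp
  with sE show ?thesis by simp
qed

lemma E_ideal_abs:
  assumes "x \<in> E" "\<bar>y\<bar> \<le> x"
  shows "y \<in> E"
proof -
  have "sup y 0 \<in> E" "sup (- y) 0 \<in> E"
    using assms by (auto intro!: E_ideal[OF assms(1)] intro: order_trans[OF pos_le_abs(1)]
      order_trans[OF pos_le_abs(2)] simp del: sup.bounded_iff)
  from E_diff[OF this] show ?thesis unfolding pos_diff_neg .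
qed

text \<open>An infimum 0 formed in \<open>E\<close> is also the infimum in the whole type: the
  positive part of a lower bound \<open>c\<close>, if nonzero, would dominate some
  \<open>v > 0\<close> of \<open>E\<close>, and \<open>v\<close> would be a lower bound as
  well.\<close>

lemma inf_in_lower_bound:
  assumes "is_inf_in E Y 0" "\<And>y. y \<in> Y \<Longrightarrow> c \<le> y"
  shows "c \<le> 0"
proof (rule ccontr)
  assume "\<not> c \<le> 0"
  then obtain v where v: "v \<in> E" "0 < v" "v \<le> sup c 0" by (rule dense_below)
  have "\<forall>y\<in>Y. v \<le> y"
    using assms v(3) unfolding is_inf_in_def by (meson order_trans sup_least)
  then have "v \<le> 0" using assms(1) v(1) unfolding is_inf_in_def by blast
  with v(2) show False by (simp add: leD)
qed

lemma disjoint_unit: "inf c e = 0 \<Longrightarrow> c = 0"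
  using disjoint_mult_eq_0[of c e] by (simp add: unit_right)

section \<open>Truncation at multiples of the unit\<close>

definition trunc :: "nat \<Rightarrow> 'a \<Rightarrow> 'a" where
  "trunc n x = inf x (real n *\<^sub>R e)"

lemma ne_nonneg: "0 \<le> real n *\<^sub>R e"
  by (intro scaleR_nonneg_nonneg e_nonneg) simp

lemma ne_mono: "m \<le> n \<Longrightarrow> real m *\<^sub>R e \<le> real n *\<^sub>R e"
  by (intro scaleR_right_mono) (auto simp: e_nonneg)

lemma ne_in_E: "r *\<^sub>R e \<in> E"
  by (intro E_scaleR e_in_E)

lemma trunc_le: "trunc n x \<le> x" and trunc_le_ne: "trunc n x \<le> real n *\<^sub>R e"
  and trunc_nonneg: "0 \<le> x \<Longrightarrow> 0 \<le> trunc n x"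
  and trunc_mono: "x \<le> y \<Longrightarrow> trunc n x \<le> trunc n y"
  by (auto simp: trunc_def ne_nonneg le_infI1)

lemma trunc_mono_index: "m \<le> n \<Longrightarrow> trunc m x \<le> trunc n x"
  using ne_mono[of m n] by (auto simp: trunc_def le_infI2)

text \<open>Because \<open>E\<close> is an ideal containing \<open>e\<close>, truncation brings
  every positive element of the type into \<open>E\<close>. This is what lets sequences of
  truncations replace arbitrary nets.\<close>

lemma trunc_in_E: "0 \<le> x \<Longrightarrow> trunc n x \<in> E"
  by (rule E_ideal[OF ne_in_E[of "real n"]]) (auto simp: trunc_nonneg trunc_le_ne)

lemma trunc_trunc: "m \<le> n \<Longrightarrow> trunc m (trunc n x) = trunc m x"
  using ne_mono[of m n] by (simp add: trunc_def inf_assoc inf_absorb2)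

lemma trunc_add_le:
  assumes "0 \<le> x" "0 \<le> y"
  shows "trunc n (x + y) \<le> trunc n x + trunc n y"
proof -
  let ?n = "real n *\<^sub>R e"
  have "inf (x + y) ?n \<le> x + ?n" "inf (x + y) ?n \<le> ?n + y" "inf (x + y) ?n \<le> ?n + ?n"
    using assms ne_nonneg[of n] by (auto intro!: le_infI2 simp: add_increasing add_increasing2)
  then show ?thesis
    unfolding trunc_def add_inf_distrib_left add_inf_distrib_right by simp
qed

lemma trunc_add_ge: "trunc m x + trunc n y \<le> trunc (m + n) (x + y)"
proof -
  have "trunc m x + trunc n y \<le> real m *\<^sub>R e + real n *\<^sub>R e"
    by (intro add_mono trunc_le_ne)
  moreover have "trunc m x + trunc n y \<le> x + y"
    by (intro add_mono trunc_le)
  ultimately show ?thesis by (simp add: trunc_def scaleR_add_left)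
qed

text \<open>The part cut off is the positive part of \<open>x - n e\<close>, which is monotone in
  \<open>x\<close>.\<close>

lemma trunc_diff_le:
  assumes "x \<le> y"
  shows "trunc n y - trunc n x \<le> y - x"
proof -
  have "sup (x - real n *\<^sub>R e) 0 \<le> sup (y - real n *\<^sub>R e) 0"
    by (intro sup_mono diff_right_mono assms order_refl)
  then have "x - trunc n x \<le> y - trunc n y" unfolding trunc_def diff_inf_eq_pos .
  then show ?thesis by (simp add: algebra_simps)
qed

text \<open>A Chebyshev estimate: a nonnegative square yields
  \<open>r (x - r e) \<le> x * x\<close>, so what exceeds height \<open>r\<close> is at most
  \<open>x * x\<close> divided by \<open>r\<close>.\<close>

lemma trunc_error: "x - trunc (Suc n) x \<le> (1 / real (Suc n)) *\<^sub>R (x * x)"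
proof -
  define r where "r = real (Suc n)"
  have r: "0 < r" by (simp add: r_def)
  \<comment> \<open>The shift \<open>r / 2\<close> produces the mixed term \<open>r x\<close>; the
    added multiple of \<open>e\<close> raises the constant term from a quarter of
    \<open>r * r\<close> to \<open>r * r\<close>.\<close>
  have "0 \<le> (x - (r / 2) *\<^sub>R e) * (x - (r / 2) *\<^sub>R e) + (3 / 4 * r * r) *\<^sub>R e"
    by (intro add_nonneg_nonneg square_nonneg scaleR_nonneg_nonneg) (use r e_nonneg in auto)
  also have "\<dots> = x * x - r *\<^sub>R x + (r * r) *\<^sub>R e"
    by (simp add: algebra_simps unit unit_right flip: scaleR_add_left)
  finally have "r *\<^sub>R (x - r *\<^sub>R e) \<le> x * x" by (simp add: algebra_simps)
  from scaleR_left_mono[OF this, of "1 / r"] r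
  have "x - r *\<^sub>R e \<le> (1 / r) *\<^sub>R (x * x)" by simp
  moreover have "0 \<le> (1 / r) *\<^sub>R (x * x)"
    by (intro scaleR_nonneg_nonneg square_nonneg) (use r in auto)
  ultimately show ?thesis unfolding trunc_def diff_inf_eq_pos r_def by simp
qed

lemma trunc_null: "null_seq (\<lambda>n. x - trunc n x)"
proof (rule null_seqI)
  fix c assume "\<And>n. c \<le> x - trunc n x"
  then show "c \<le> 0"
    by (intro archimedean_inverse[of c "x * x"]) (blast intro: order_trans trunc_error)
qed (auto simp: trunc_le intro: diff_left_mono trunc_mono_index)

text \<open>A truncation of \<open>z\<close> is bounded by a multiple of \<open>e\<close> and
  multiplies \<open>X n\<close> like a scalar, while the remainder times \<open>X 0\<close> is small
  by \<open>trunc_error\<close>. The limit in \<open>n\<close> is taken before the one in the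
  truncation height.\<close>

lemma null_seq_mult:
  fixes z :: 'a
  assumes X: "null_seq X" and z: "0 \<le> z"
  shows "null_seq (\<lambda>n. z * X n)"
proof (rule null_seqI)
  fix c assume c: "\<And>n. c \<le> z * X n"
  have "c \<le> (1 / real (Suc m)) *\<^sub>R (z * z * X 0)" for m
  proof -
    let ?t = "trunc (Suc m) z"
    have "c - (1 / real (Suc m)) *\<^sub>R (z * z * X 0) \<le> 0"
    proof (rule null_seqD[OF null_seq_scaleR[OF X]])
      fix n
      have "c \<le> ?t * X n + (z - ?t) * X n"
        using c[of n] by (simp add: algebra_simps)
      also have "?t * X n \<le> (real (Suc m) *\<^sub>R e) * X n"
        by (intro mult_right_mono trunc_le_ne null_seq_nonneg[OF X])
      also have "(real (Suc m) *\<^sub>R e) * X n = real (Suc m) *\<^sub>R X n"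
        by (simp add: unit)
      also have "(z - ?t) * X n \<le> (z - ?t) * X 0"
        by (intro mult_left_mono null_seq_antimono[OF X]) (auto simp: trunc_le)
      also have "(z - ?t) * X 0 \<le> ((1 / real (Suc m)) *\<^sub>R (z * z)) * X 0"
        by (intro mult_right_mono trunc_error null_seq_nonneg[OF X])
      finally show "c - (1 / real (Suc m)) *\<^sub>R (z * z * X 0) \<le> real (Suc m) *\<^sub>R X n"
        by (simp only: diff_le_eq mult_scaleR_left) simp
    qed simp
    then show ?thesis by simp
  qed
  then show "c \<le> 0" by (rule archimedean_inverse)
qed (auto intro!: mult_left_mono mult_nonneg_nonneg null_seq_antimono[OF X] null_seq_nonneg[OF X] z)

end

locale positive_operator = dense_riesz_subspace E e
  for E :: "'a::universally_complete_f_algebra set" and e :: 'a +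
  fixes U :: "'a \<Rightarrow> 'a"
  assumes linear: "linear_operator_on E U"
    and nonneg: "\<And>x. x \<in> E \<Longrightarrow> 0 \<le> x \<Longrightarrow> 0 \<le> U x"
    and order_continuous: "order_continuous_on E U"
begin

lemma in_E: "x \<in> E \<Longrightarrow> U x \<in> E"
  and add: "x \<in> E \<Longrightarrow> y \<in> E \<Longrightarrow> U (x + y) = U x + U y"
  and scaleR: "x \<in> E \<Longrightarrow> U (r *\<^sub>R x) = r *\<^sub>R U x"
  using linear unfolding linear_operator_on_def by auto

lemma zero: "U 0 = 0"
  using scaleR[OF E_zero, of 0] by simp

lemma uminus: "x \<in> E \<Longrightarrow> U (- x) = - U x"
  using scaleR[of x "-1"] by simp

lemma diff: "x \<in> E \<Longrightarrow> y \<in> E \<Longrightarrow> U (x - y) = U x - U y"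
  using add[of x "- y"] by (simp add: E_uminus uminus)

lemma sum: "finite I \<Longrightarrow> (\<And>i. i \<in> I \<Longrightarrow> f i \<in> E) \<Longrightarrow> U (sum f I) = (\<Sum>i\<in>I. U (f i))"
  by (induction I rule: finite_induct) (auto simp: zero add E_sum)

lemma mono: "x \<in> E \<Longrightarrow> y \<in> E \<Longrightarrow> x \<le> y \<Longrightarrow> U x \<le> U y"
  using nonneg[of "y - x"] by (simp add: E_diff diff)

lemma abs_le: "x \<in> E \<Longrightarrow> \<bar>U x\<bar> \<le> U \<bar>x\<bar>"
proof (intro abs_leI)
  assume x: "x \<in> E"
  show "U x \<le> U \<bar>x\<bar>" by (rule mono[OF x E_abs[OF x] abs_ge_self])
  show "- U x \<le> U \<bar>x\<bar>"
    using mono[OF E_uminus[OF x] E_abs[OF x] abs_ge_minus_self] unfolding uminus[OF x] .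
qed

text \<open>Translates order continuity, stated for filters, into the form used below: when
  \<open>D\<close> decreases to 0, the images under \<open>U\<close> have no lower bounds except
  those at most 0.\<close>

lemma directed:
  assumes D: "D \<subseteq> E" "down_directed D" "\<And>d. d \<in> D \<Longrightarrow> 0 \<le> d"
    and lower: "\<And>c. (\<And>d. d \<in> D \<Longrightarrow> c \<le> d) \<Longrightarrow> c \<le> 0"
    and c: "\<And>d. d \<in> D \<Longrightarrow> c \<le> U d"
  shows "c \<le> 0"
proof -
  let ?P = "\<lambda>d. principal {y \<in> D. y \<le> d}"
  \<comment> \<open>The filter of tails of \<open>D\<close> taken as a decreasing net;
    \<open>D\<close> itself then dominates the identity along \<open>F\<close>.\<close>
  define F where "F = (INF d\<in>D. ?P d)"
  have ev: "eventually P F \<longleftrightarrow> (\<exists>d\<in>D. \<forall>y\<in>D. y \<le> d \<longrightarrow> P y)" for P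
    unfolding F_def
  proof (subst eventually_INF_base)
    show "D \<noteq> {}" using D(2) by (auto simp: down_directed_def)
    fix a b assume "a \<in> D" "b \<in> D"
    then obtain d where "d \<in> D" "d \<le> a" "d \<le> b"
      using D(2) unfolding down_directed_def by blast
    then show "\<exists>x\<in>D. ?P x \<le> inf (?P a) (?P b)"
      by (intro bexI[of _ d]) auto
  qed (auto simp: eventually_principal)
  have "order_tendsto_in E (\<lambda>y. y) 0 F"
    unfolding order_tendsto_in_def
  proof (intro exI[of _ D] conjI ballI)
    show "is_inf_in E D 0"
      unfolding is_inf_in_def
    proof (intro conjI ballI impI E_zero D(3))
      show "u \<le> 0" if "\<forall>d\<in>D. u \<le> d" for u
        by (rule lower) (use that in simp)
    qed
    fix d assume "d \<in> D"
    then show "\<forall>\<^sub>F y in F. \<bar>y - 0\<bar> \<le> d"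
      unfolding ev by (intro bexI[of _ d]) (simp_all add: D(3))
  qed (use D in auto)
  moreover have "\<forall>\<^sub>F y in F. y \<in> E"
    unfolding ev using D(1,2) by (auto simp: down_directed_def)
  ultimately have "order_tendsto_in E U (U 0) F"
    using order_continuous E_zero unfolding order_continuous_on_def by blast
  then obtain Y where Y: "is_inf_in E Y 0" "\<And>y. y \<in> Y \<Longrightarrow> \<forall>\<^sub>F z in F. \<bar>U z - U 0\<bar> \<le> y"
    unfolding order_tendsto_in_def by blast
  show "c \<le> 0"
  proof (rule inf_in_lower_bound[OF Y(1)])
    fix y assume "y \<in> Y"
    from Y(2)[OF this] obtain d where "d \<in> D" "\<bar>U d\<bar> \<le> y"
      unfolding ev zero by auto
    with c show "c \<le> y" by (meson abs_ge_self order_trans)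
  qed
qed

lemma null_seq:
  assumes X: "null_seq X" and E: "\<And>n. X n \<in> E"
  shows "null_seq (\<lambda>n. U (X n))"
proof (rule null_seqI)
  fix c assume c: "\<And>n. c \<le> U (X n)"
  show "c \<le> 0"
  proof (rule directed[of "range X"])
    show "down_directed (range X)"
      unfolding down_directed_def
    proof (intro conjI ballI)
      fix a b assume "a \<in> range X" "b \<in> range X"
      then obtain m n where "a = X m" "b = X n" by blast
      then show "\<exists>c\<in>range X. c \<le> a \<and> c \<le> b"
        by (intro bexI[of _ "X (max m n)"]) (auto intro: null_seq_antimono[OF X])
    qed auto
  qed (use E c null_seqD[OF X] null_seq_nonneg[OF X] in auto)
qed (auto intro!: mono nonneg E null_seq_antimono[OF X] null_seq_nonneg[OF X])

section \<open>Extension of a positive operator by truncation\<close>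

definition dom :: "'a set" where
  "dom = {x. 0 \<le> x \<and> bdd_above (range (\<lambda>n. U (trunc n x)))}"

text \<open>Truncations play the role of the approximating nets. For \<open>U = T\<close> the set
  \<open>dom\<close> turns out to be \<open>natural_domain_pos E T\<close>, and \<open>ext\<close>
  the value of \<open>extend\<close> on it.\<close>

definition ext :: "'a \<Rightarrow> 'a" where
  "ext x = (SUP n. U (trunc n x))"

lemma dom_nonneg: "x \<in> dom \<Longrightarrow> 0 \<le> x"
  by (simp add: dom_def)

lemma domI: "0 \<le> x \<Longrightarrow> (\<And>n. U (trunc n x) \<le> b) \<Longrightarrow> x \<in> dom"
  by (auto simp: dom_def intro!: bdd_aboveI[of _ b])

lemma ext_upper: "x \<in> dom \<Longrightarrow> U (trunc n x) \<le> ext x"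
  unfolding ext_def dom_def by (auto intro: cSUP_upper)

lemma ext_least: "(\<And>n. U (trunc n x) \<le> b) \<Longrightarrow> ext x \<le> b"
  unfolding ext_def by (rule cSUP_least) auto

lemma U_trunc_mono: "0 \<le> x \<Longrightarrow> x \<le> y \<Longrightarrow> m \<le> n \<Longrightarrow> U (trunc m x) \<le> U (trunc n y)"
  by (intro mono trunc_in_E order_trans[OF trunc_mono trunc_mono_index]) auto

lemma ext_nonneg: "x \<in> dom \<Longrightarrow> 0 \<le> ext x"
  using ext_upper[of x 0] nonneg[of "trunc 0 x"]
  by (meson dom_nonneg order_trans trunc_in_E trunc_nonneg)

lemma ext_null:
  assumes x: "x \<in> dom"
  shows "null_seq (\<lambda>n. ext x - U (trunc n x))"
proof (rule null_seqI)
  fix c assume c: "\<And>n. c \<le> ext x - U (trunc n x)"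
  have "ext x \<le> ext x - c"
  proof (rule ext_least)
    fix n show "U (trunc n x) \<le> ext x - c" using c[of n] by (simp add: algebra_simps)
  qed
  then show "c \<le> 0" by simp
qed (use x in \<open>auto intro: diff_left_mono U_trunc_mono dom_nonneg simp: ext_upper\<close>)

lemma dom_mono: "x \<in> dom \<Longrightarrow> 0 \<le> y \<Longrightarrow> y \<le> x \<Longrightarrow> y \<in> dom"
  by (rule domI[of y "ext x"]) (blast intro: order_trans U_trunc_mono ext_upper)+

lemma ext_mono: "x \<in> dom \<Longrightarrow> 0 \<le> y \<Longrightarrow> y \<le> x \<Longrightarrow> ext y \<le> ext x"
  by (rule ext_least) (blast intro: order_trans U_trunc_mono ext_upper)

lemma dom_add_ext_le:
  assumes "x \<in> dom" "y \<in> dom"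
  shows "U (trunc n (x + y)) \<le> ext x + ext y"
proof -
  have "U (trunc n (x + y)) \<le> U (trunc n x + trunc n y)"
    using assms by (intro mono E_add trunc_in_E trunc_add_le add_nonneg_nonneg) (auto simp: dom_nonneg)
  also have "\<dots> = U (trunc n x) + U (trunc n y)"
    using assms by (intro add trunc_in_E) (auto simp: dom_nonneg)
  also have "\<dots> \<le> ext x + ext y" using assms by (intro add_mono ext_upper)
  finally show ?thesis .
qed

lemma dom_add: "x \<in> dom \<Longrightarrow> y \<in> dom \<Longrightarrow> x + y \<in> dom"
  by (rule domI[OF add_nonneg_nonneg dom_add_ext_le]) (auto simp: dom_nonneg)

text \<open>Truncation is subadditive at a fixed height and superadditive when the heights are
  added; these two facts give the two inequalities.\<close>

lemma ext_add:
  assumes x: "x \<in> dom" and y: "y \<in> dom"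
  shows "ext (x + y) = ext x + ext y"
proof (rule antisym)
  show "ext (x + y) \<le> ext x + ext y" by (rule ext_least) (rule dom_add_ext_le[OF assms])
  have le: "U (trunc m x) + U (trunc n y) \<le> ext (x + y)" for m n
  proof -
    have "U (trunc m x) + U (trunc n y) = U (trunc m x + trunc n y)"
      using assms by (intro add[symmetric] trunc_in_E) (auto simp: dom_nonneg)
    also have "\<dots> \<le> U (trunc (m + n) (x + y))"
      using assms by (intro mono E_add trunc_in_E trunc_add_ge add_nonneg_nonneg) (auto simp: dom_nonneg)
    also have "\<dots> \<le> ext (x + y)" by (intro ext_upper dom_add assms)
    finally show ?thesis .
  qed
  have "ext x \<le> ext (x + y) - U (trunc n y)" for n
    by (rule ext_least) (use le in \<open>simp add: le_diff_eq\<close>)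
  then have "ext y \<le> ext (x + y) - ext x"
    by (intro ext_least) (simp add: algebra_simps)
  then show "ext x + ext y \<le> ext (x + y)" by (simp add: algebra_simps)
qed

lemma ext_diff:
  assumes "x \<in> dom" "0 \<le> y" "y \<le> x"
  shows "ext (x - y) = ext x - ext y"
proof -
  have "x - y \<in> dom" "y \<in> dom" using assms by (auto intro: dom_mono)
  from ext_add[OF this] show ?thesis by simp
qed

lemma dom_E: assumes "x \<in> E" "0 \<le> x" shows "x \<in> dom"
  by (rule domI[of _ "U x"]) (use assms in \<open>auto intro: mono trunc_in_E trunc_le\<close>)

text \<open>Order continuity enters here: \<open>x - trunc n x\<close> decreases to 0 in
  \<open>E\<close>, so no mass of \<open>U x\<close> is lost along the truncations.\<close>

lemma ext_E:
  assumes "x \<in> E" "0 \<le> x"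
  shows "ext x = U x"
proof (rule antisym)
  show "ext x \<le> U x"
    by (rule ext_least) (use assms in \<open>auto intro: mono trunc_in_E trunc_le\<close>)
  have "U x - ext x \<le> 0"
  proof (rule null_seqD[OF null_seq[OF trunc_null[of x]]])
    show "x - trunc n x \<in> E" for n using assms by (auto intro: E_diff trunc_in_E)
    show "U x - ext x \<le> U (x - trunc n x)" for n
      using assms ext_upper[OF dom_E[OF assms], of n] by (simp add: diff trunc_in_E)
  qed
  then show "U x \<le> ext x" by simp
qed

text \<open>For fixed \<open>n\<close> the differences between \<open>trunc n x\<close> and the
  truncated members of \<open>A\<close> decrease to 0, since they are at most \<open>x - a\<close>.
  Order continuity therefore carries a bound from the net over to the truncations.\<close>

lemma up_directed_bound:
  assumes A: "A \<subseteq> E" "\<forall>a\<in>A. 0 \<le> a" "up_directed A" "is_sup_in UNIV A x"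
    and b: "\<And>a. a \<in> A \<Longrightarrow> U a \<le> b"
  shows "U (trunc n x) \<le> b"
proof -
  have Ax: "\<And>a. a \<in> A \<Longrightarrow> a \<le> x" and least: "\<And>u. (\<And>a. a \<in> A \<Longrightarrow> a \<le> u) \<Longrightarrow> x \<le> u"
    using A(4) by (auto simp: is_sup_in_def)
  have ne: "A \<noteq> {}" using A(3) by (auto simp: up_directed_def)
  then have x0: "0 \<le> x" using A(2) Ax by (meson all_not_in_conv order_trans)
  let ?D = "(\<lambda>a. trunc n x - trunc n a) ` A"
  have "U (trunc n x) - b \<le> 0"
  proof (rule directed[of ?D])
    show "?D \<subseteq> E" using A(1,2) x0 by (auto intro!: E_diff trunc_in_E)
    show "down_directed ?D"
      unfolding down_directed_def
    proof (intro conjI ballI)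
      fix p q assume "p \<in> ?D" "q \<in> ?D"
      then obtain a a' where aa: "a \<in> A" "a' \<in> A" "p = trunc n x - trunc n a" "q = trunc n x - trunc n a'"
        by auto
      then obtain a'' where "a'' \<in> A" "a \<le> a''" "a' \<le> a''"
        using A(3) unfolding up_directed_def by blast
      with aa show "\<exists>c\<in>?D. c \<le> p \<and> c \<le> q"
        by (intro bexI[of _ "trunc n x - trunc n a''"]) (auto intro: diff_left_mono trunc_mono)
    qed (use ne in auto)
    show "0 \<le> d" if "d \<in> ?D" for d
      using that Ax by (auto intro!: trunc_mono)
    show "U (trunc n x) - b \<le> U d" if "d \<in> ?D" for d
    proof -
      from that obtain a where a: "a \<in> A" "d = trunc n x - trunc n a" by auto
      have aE: "a \<in> E" "0 \<le> a" using a A by auto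
      have "U (trunc n a) \<le> U a"
        by (intro mono trunc_in_E trunc_le aE)
      also have "\<dots> \<le> b" by (rule b[OF a(1)])
      finally show ?thesis using aE x0 by (simp add: a(2) diff trunc_in_E)
    qed
    fix c assume c: "\<And>d. d \<in> ?D \<Longrightarrow> c \<le> d"
    have "x \<le> x - c"
    proof (rule least)
      fix a assume a: "a \<in> A"
      have "c \<le> trunc n x - trunc n a" using c a by blast
      also have "\<dots> \<le> x - a" by (rule trunc_diff_le[OF Ax[OF a]])
      finally show "a \<le> x - c" by (simp add: algebra_simps)
    qed
    then show "c \<le> 0" by simp
  qed
  then show ?thesis by simp
qed

text \<open>Independence of the net: \<open>up_directed_bound\<close> makes every bound of the
  images a bound of \<open>ext x\<close>, and monotonicity of \<open>ext\<close> gives the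
  converse.\<close>

lemma ext_unique:
  assumes A: "A \<subseteq> E" "\<forall>a\<in>A. 0 \<le> a" "up_directed A" "is_sup_in UNIV A x"
    and x: "x \<in> dom"
  shows "(SUP a\<in>A. U a) = ext x"
proof (rule cSup_eq_non_empty)
  show "U ` A \<noteq> {}" using A(3) by (auto simp: up_directed_def)
  fix b assume "b \<in> U ` A"
  then obtain a where a: "a \<in> A" "b = U a" by auto
  then have "a \<in> E" "0 \<le> a" "a \<le> x" using A by (auto simp: is_sup_in_def)
  then show "b \<le> ext x" using ext_mono[OF x, of a] by (simp add: ext_E a(2))
next
  fix b assume "\<And>z. z \<in> U ` A \<Longrightarrow> z \<le> b"
  then show "ext x \<le> b" by (intro ext_least up_directed_bound[OF A]) auto
qed

end

section \<open>The Schwarz inequality and the averaging property\<close>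

text \<open>With \<open>p\<close> and \<open>n\<close> the positive and negative parts of
  \<open>w\<close>, the two arguments are \<open>d + p\<close> and \<open>n + p\<close>, so the meet
  is \<open>inf d n + p\<close>. The two summands are disjoint, hence their sum is a supremum. This
  is the induction step of the grid argument below.\<close>

lemma inf_abs_le:
  fixes w d :: "'a::riesz_space"
  assumes "0 \<le> d"
  shows "inf (sup d (w + d)) \<bar>w\<bar> \<le> sup d w"
proof -
  let ?p = "sup w 0" and ?n = "sup (- w) 0"
  have "sup d (w + d) = d + ?p"
    using add_sup_distrib_left[of d w 0] by (simp add: add.commute sup_commute)
  then have "inf (sup d (w + d)) \<bar>w\<bar> = inf d ?n + ?p"
    unfolding add_inf_distrib_right by (simp only: pos_add_neg[symmetric] add.commute)
  also have "\<dots> = sup (inf d ?n) ?p"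
  proof -
    have "inf (inf d ?n) ?p = 0"
      by (rule disjoint_mono[of ?n ?p]) (use assms inf_pos_neg[of w] in \<open>auto simp: inf_commute\<close>)
    then show ?thesis by (metis add_eq_inf_sup add.right_neutral)
  qed
  also have "\<dots> \<le> sup d w"
    using assms by (auto intro: le_supI1 le_infI1)
  finally show ?thesis .
qed

context dense_riesz_subspace
begin

lemma square_unit_diff:
  "(x - r *\<^sub>R e) * (x - r *\<^sub>R e) = x * x - (2 * r) *\<^sub>R x + (r * r) *\<^sub>R e"
proof -
  have "(2 * r) *\<^sub>R x = r *\<^sub>R x + r *\<^sub>R x" by (simp flip: scaleR_add_left)
  then show ?thesis by (simp add: algebra_simps unit unit_right)
qed

text \<open>For real numbers one would choose \<open>r = y\<close>. Here finitely many scalars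
  forming a grid of mesh \<delta> are used at once: every value of \<open>y\<close> is close to some
  grid point, and the meet of the corresponding squares is of order
  \<open>\<delta> * \<delta>\<close>.\<close>

lemma le_zero_if_le_squares:
  assumes y: "\<bar>y\<bar> \<le> M *\<^sub>R e" and d: "\<And>r. d \<le> (y - r *\<^sub>R e) * (y - r *\<^sub>R e)"
  shows "d \<le> 0"
proof (rule archimedean_inverse)
  fix n
  define \<delta> where "\<delta> = 1 / real (Suc n)"
  \<comment> \<open>The shift moves the range of \<open>y\<close> into the interval from 0 to
    \<open>2 M e\<close>, so that the grid can start at 0.\<close>
  define z where "z = y + M *\<^sub>R e"
  have \<delta>: "0 < \<delta>" "\<delta> \<le> 1" by (auto simp: \<delta>_def)
  have z0: "0 \<le> z" "z \<le> (2 * M) *\<^sub>R e"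
  proof -
    have "- y \<le> M *\<^sub>R e" "y \<le> M *\<^sub>R e"
      using y abs_ge_self abs_ge_minus_self order_trans by blast+
    moreover have "(2 * M) *\<^sub>R e = M *\<^sub>R e + M *\<^sub>R e" by (simp flip: scaleR_add_left)
    ultimately show "0 \<le> z" "z \<le> (2 * M) *\<^sub>R e"
      using add_right_mono[of "- y" "M *\<^sub>R e" y] by (simp_all add: z_def add.commute[of y])
  qed
  have dz: "d \<le> (z - r *\<^sub>R e) * (z - r *\<^sub>R e)" for r
    using d[of "r - M"] by (simp add: z_def scaleR_diff_left algebra_simps)
  \<comment> \<open>The element \<open>r\<close> is the meet of \<open>z\<close> with its distances
    to the first \<open>k\<close> further grid points. By \<open>inf_squares\<close>,
    \<open>d\<close> stays below its square; the last bound says that only the part of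
    \<open>z\<close> beyond the grid can still be large.\<close>
  have grid: "\<exists>r. 0 \<le> r \<and> d \<le> r * r \<and> r \<le> sup (\<delta> *\<^sub>R e) (z - (real k * \<delta>) *\<^sub>R e)" for k
  proof (induction k)
    case 0
    show ?case using dz[of 0] z0 by (intro exI[of _ z]) simp
  next
    case (Suc k)
    then obtain r where r: "0 \<le> r" "d \<le> r * r" "r \<le> sup (\<delta> *\<^sub>R e) (z - (real k * \<delta>) *\<^sub>R e)"
      by blast
    let ?w = "z - (real (Suc k) * \<delta>) *\<^sub>R e"
    have w: "z - (real k * \<delta>) *\<^sub>R e = ?w + \<delta> *\<^sub>R e"
      by (simp add: algebra_simps)
    have "d \<le> inf (r * r) (\<bar>?w\<bar> * \<bar>?w\<bar>)"
      unfolding abs_square using r dz by simp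
    also have "\<dots> \<le> inf r \<bar>?w\<bar> * inf r \<bar>?w\<bar>"
      by (rule inf_squares) (use r in auto)
    finally have "d \<le> inf r \<bar>?w\<bar> * inf r \<bar>?w\<bar>" .
    moreover have "inf r \<bar>?w\<bar> \<le> sup (\<delta> *\<^sub>R e) ?w"
    proof -
      have "inf r \<bar>?w\<bar> \<le> inf (sup (\<delta> *\<^sub>R e) (?w + \<delta> *\<^sub>R e)) \<bar>?w\<bar>"
        using r(3) unfolding w by (intro inf_mono) auto
      also have "\<dots> \<le> sup (\<delta> *\<^sub>R e) ?w"
        by (rule inf_abs_le) (use \<delta> e_nonneg in \<open>auto intro: scaleR_nonneg_nonneg\<close>)
      finally show ?thesis .
    qed
    moreover have "0 \<le> inf r \<bar>?w\<bar>" using r(1) by simp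
    ultimately show ?case by blast
  qed
  \<comment> \<open>Once the grid has covered the length \<open>2 * M\<close> of the range, only the
    mesh size remains.\<close>
  obtain k where k: "2 * M / \<delta> \<le> real k" using real_arch_simple by blast
  then have "2 * M \<le> real k * \<delta>" using \<delta> by (simp add: field_simps)
  then have "z \<le> (real k * \<delta>) *\<^sub>R e"
    using z0(2) scaleR_right_mono[OF _ e_nonneg] order_trans by blast
  moreover have "0 \<le> \<delta> *\<^sub>R e" using \<delta> e_nonneg by (intro scaleR_nonneg_nonneg) auto
  ultimately have le: "sup (\<delta> *\<^sub>R e) (z - (real k * \<delta>) *\<^sub>R e) = \<delta> *\<^sub>R e"
    by (intro sup_absorb1) (meson diff_le_0_iff_le order_trans)
  from grid[of k] obtain r where r: "0 \<le> r" "d \<le> r * r" "r \<le> \<delta> *\<^sub>R e" unfolding le by blast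
  note r(2)
  also have "r * r \<le> (\<delta> *\<^sub>R e) * (\<delta> *\<^sub>R e)"
    using r by (intro mult_mono) auto
  also have "\<dots> = (\<delta> * \<delta>) *\<^sub>R e" by (simp add: unit)
  also have "\<dots> \<le> \<delta> *\<^sub>R e"
    using \<delta> mult_left_mono[of \<delta> 1 \<delta>] by (intro scaleR_right_mono e_nonneg) auto
  finally show "d \<le> (1 / real (Suc n)) *\<^sub>R e" unfolding \<delta>_def .
qed

text \<open>With \<open>x * x = 0\<close>, positivity of the square of
  \<open>\<bar>x\<bar> - r e\<close> reads \<open>2 r \<bar>x\<bar> \<le> r r e\<close>; dividing by
  \<open>r\<close> and letting it tend to 0 finishes.\<close>

lemma square_eq_0:
  assumes "x * x = (0::'a)"
  shows "x = 0"
proof -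
  let ?y = "\<bar>x\<bar>"
  have "?y \<le> 0"
  proof (rule archimedean_inverse)
    fix n
    define r where "r = 1 / real (Suc n)"
    have r: "0 < r" by (simp add: r_def)
    have "0 \<le> ?y * ?y - (2 * r) *\<^sub>R ?y + (r * r) *\<^sub>R e"
      using square_nonneg[of "?y - r *\<^sub>R e"] unfolding square_unit_diff .
    then have "(2 * r) *\<^sub>R ?y \<le> (r * r) *\<^sub>R e"
      unfolding abs_square assms by simp
    from scaleR_left_mono[OF this, of "1 / r"] r
    have "2 *\<^sub>R ?y \<le> r *\<^sub>R e" by simp
    moreover have "?y \<le> 2 *\<^sub>R ?y" by (simp add: scaleR_2)
    ultimately show "?y \<le> (1 / real (Suc n)) *\<^sub>R e"
      unfolding r_def using order_trans by blast
  qed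
  then show ?thesis by simp
qed

section \<open>Elements bounded by a multiple of the unit\<close>

abbreviation B :: "'a set" where
  "B \<equiv> principal_ideal E e"

lemma BI: "\<bar>x\<bar> \<le> M *\<^sub>R e \<Longrightarrow> x \<in> B"
  unfolding principal_ideal_def
proof (intro CollectI conjI exI[of _ "max M 0"])
  assume x: "\<bar>x\<bar> \<le> M *\<^sub>R e"
  show "x \<in> E" by (rule E_ideal_abs[OF ne_in_E x])
  show "\<bar>x\<bar> \<le> max M 0 *\<^sub>R e"
    by (rule order_trans[OF x scaleR_right_mono]) (auto simp: e_nonneg)
qed simp

lemma BE:
  assumes "x \<in> B"
  obtains M where "0 \<le> M" "\<bar>x\<bar> \<le> M *\<^sub>R e"
  using assms unfolding principal_ideal_def by blast

lemma B_E: "x \<in> B \<Longrightarrow> x \<in> E"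
  by (simp add: principal_ideal_def)

lemma B_scaleR: "x \<in> B \<Longrightarrow> r *\<^sub>R x \<in> B"
  by (erule BE, rule BI[of _ "\<bar>r\<bar> * M" for M], simp only: abs_scaleR flip: scaleR_scaleR,
      rule scaleR_left_mono) auto

lemma B_e: "e \<in> B"
  by (rule BI[of _ 1]) (simp add: e_nonneg)

lemma B_add: "x \<in> B \<Longrightarrow> y \<in> B \<Longrightarrow> x + y \<in> B"
  by (elim BE, rule BI[of _ "M + N" for M N], simp only: scaleR_add_left)
    (rule order_trans[OF abs_triangle_ineq add_mono])

lemma B_mono: "x \<in> B \<Longrightarrow> \<bar>y\<bar> \<le> \<bar>x\<bar> \<Longrightarrow> y \<in> B"
  by (elim BE, rule BI) (rule order_trans)

lemma B_between: "x \<in> B \<Longrightarrow> 0 \<le> y \<Longrightarrow> y \<le> x \<Longrightarrow> y \<in> B"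
  by (rule B_mono[of x]) (auto intro: order_trans abs_ge_self)

lemma B_diff: "x \<in> B \<Longrightarrow> y \<in> B \<Longrightarrow> x - y \<in> B"
  using B_add[of x "(-1) *\<^sub>R y"] B_scaleR[of y "-1"] by simp

lemma B_mult:
  assumes "x \<in> B" "y \<in> B"
  shows "x * y \<in> B"
proof -
  obtain M where M: "0 \<le> M" "\<bar>x\<bar> \<le> M *\<^sub>R e" using assms BE by blast
  obtain N where N: "0 \<le> N" "\<bar>y\<bar> \<le> N *\<^sub>R e" using assms BE by blast
  have "\<bar>x * y\<bar> \<le> \<bar>x\<bar> * \<bar>y\<bar>" by (rule abs_le_mult)
  also have "\<dots> \<le> (M *\<^sub>R e) * (N *\<^sub>R e)"
    by (intro mult_mono M N scaleR_nonneg_nonneg e_nonneg) auto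
  also have "\<dots> = (M * N) *\<^sub>R e" by (simp add: unit)
  finally show ?thesis by (rule BI)
qed

lemma trunc_in_B: "0 \<le> x \<Longrightarrow> trunc n x \<in> B"
  by (rule BI[of _ "real n"]) (simp add: trunc_nonneg trunc_le_ne)

end

locale unital_operator = positive_operator E e U
  for E :: "'a::universally_complete_f_algebra set" and e :: 'a and U :: "'a \<Rightarrow> 'a" +
  assumes unital: "U e = e"
begin

lemma abs_le_unit: "\<bar>x\<bar> \<le> M *\<^sub>R e \<Longrightarrow> \<bar>U x\<bar> \<le> M *\<^sub>R e"
proof -
  assume x: "\<bar>x\<bar> \<le> M *\<^sub>R e"
  have xE: "x \<in> E" by (rule E_ideal_abs[OF ne_in_E x])
  have "\<bar>U x\<bar> \<le> U \<bar>x\<bar>" by (rule abs_le[OF xE])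
  also have "\<dots> \<le> U (M *\<^sub>R e)" by (intro mono E_abs xE ne_in_E x)
  also have "\<dots> = M *\<^sub>R e" by (simp add: scaleR e_in_E unital)
  finally show ?thesis .
qed

lemma in_B: "x \<in> B \<Longrightarrow> U x \<in> B"
  by (elim BE, rule BI, rule abs_le_unit)

text \<open>Expanding the positive element \<open>U ((x - r e) * (x - r e))\<close> bounds the
  defect \<open>U x * U x - U (x * x)\<close> by the square of \<open>U x - r e\<close> for every
  real \<open>r\<close>, so \<open>le_zero_if_le_squares\<close> applies.\<close>

lemma schwarz:
  assumes "x \<in> B"
  shows "U x * U x \<le> U (x * x)"
proof -
  obtain M where M: "\<bar>x\<bar> \<le> M *\<^sub>R e" using assms BE by blast
  have "U x * U x - U (x * x) \<le> 0"
  proof (rule le_zero_if_le_squares[OF abs_le_unit[OF M]])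
    fix r
    have xE: "x \<in> E" "x * x \<in> E" using assms by (auto intro: B_E B_mult)
    have "0 \<le> U ((x - r *\<^sub>R e) * (x - r *\<^sub>R e))"
      by (intro nonneg square_nonneg B_E B_mult B_diff B_scaleR B_e assms)
    also have "\<dots> = U (x * x) - (2 * r) *\<^sub>R U x + (r * r) *\<^sub>R e"
      unfolding square_unit_diff
      by (simp add: add diff scaleR xE E_diff E_scaleR ne_in_E e_in_E unital)
    finally show "U x * U x - U (x * x) \<le> (U x - r *\<^sub>R e) * (U x - r *\<^sub>R e)"
      unfolding square_unit_diff by (simp add: algebra_simps)
  qed
  then show ?thesis by simp
qed

end

locale expectation_preserving = conditional_expectation_preserving_system E T S e
  for E :: "'a::universally_complete_f_algebra set" and T S :: "'a \<Rightarrow> 'a" and e :: 'a +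
  assumes order_dense: "order_dense E" and unit: "e * x = x"

sublocale expectation_preserving \<subseteq> dense_riesz_subspace E e
  using weak_order_unit unfolding weak_order_unit_def
  by unfold_locales (auto simp: riesz_subspace dedekind_complete order_dense unit)

sublocale expectation_preserving \<subseteq> T: unital_operator E e T
proof unfold_locales
  fix x assume x: "x \<in> E" "0 \<le> x"
  have "T 0 = 0" using T_linear E_zero unfolding linear_operator_on_def by (metis scaleR_zero_left)
  then show "0 \<le> T x" using T_strictly_positive[OF x(1)] x(2) by (cases "x = 0") (auto simp: less_le)
qed (auto simp: T_linear T_order_continuous T_unit)

sublocale expectation_preserving \<subseteq> S: unital_operator E e S
proof unfold_locales
  show lin: "linear_operator_on E S"
    using S_homomorphism by (simp add: riesz_homomorphism_on_def)
  fix x assume x: "x \<in> E" "0 \<le> x"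
  have "S 0 = 0" using lin E_zero unfolding linear_operator_on_def by (metis scaleR_zero_left)
  moreover have "S (sup x 0) = sup (S x) (S 0)"
    using S_homomorphism x(1) E_zero unfolding riesz_homomorphism_on_def by blast
  moreover have "sup x 0 = x" using x(2) by (simp add: sup_absorb1)
  ultimately show "0 \<le> S x" by (metis sup.cobounded2)
qed (auto simp: S_order_continuous S_unit)

context expectation_preserving
begin

lemma S_inf: "x \<in> E \<Longrightarrow> y \<in> E \<Longrightarrow> S (inf x y) = inf (S x) (S y)"
  and S_sup: "x \<in> E \<Longrightarrow> y \<in> E \<Longrightarrow> S (sup x y) = sup (S x) (S y)"
  using S_homomorphism unfolding riesz_homomorphism_on_def by blast+

section \<open>Strict positivity and the averaging property\<close>

lemma T_eq_0:
  assumes "x \<in> E" "0 \<le> x" "T x \<le> 0"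
  shows "x = 0"
  using T_strictly_positive[OF assms(1)] assms(2,3) by (auto simp: less_le)

text \<open>The Schwarz inequality gives one direction; \<open>T\<close> annihilates the difference,
  so strict positivity makes it 0.\<close>

lemma T_square:
  assumes v: "v \<in> B" "T v = v"
  shows "T (v * v) = v * v"
proof -
  have E: "v * v \<in> E" using v by (auto intro: B_E B_mult)
  have le: "v * v \<le> T (v * v)" using T.schwarz[OF v(1)] v by simp
  have "T (v * v) - v * v = 0"
    by (rule T_eq_0) (use E le in \<open>auto intro: E_diff T.in_E simp: T.diff T.in_E T_projection\<close>)
  then show ?thesis by simp
qed

text \<open>In the Schwarz inequality for \<open>x + t v\<close> the terms quadratic in
  \<open>t\<close> cancel by \<open>T_square\<close>. What is left bounds \<open>2 t z\<close>
  independently of \<open>t\<close>, for both signs of \<open>t\<close>, and the Archimedean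
  property gives \<open>z = 0\<close>.\<close>

lemma averaging:
  assumes v: "v \<in> B" "T v = v" and x: "x \<in> B"
  shows "T (v * x) = v * T x"
proof -
  define z where "z = v * T x - T (v * x)"
  have E: "v \<in> E" "x \<in> E" "v * x \<in> E" "v * v \<in> E" "x * x \<in> E"
    using v x by (auto intro: B_E B_mult)
  have main: "(2 * t) *\<^sub>R z \<le> T (x * x) - T x * T x" for t
  proof -
    have 2: "(2 * t) *\<^sub>R y = t *\<^sub>R y + t *\<^sub>R y" for y :: 'a
      unfolding scaleR_add_left[symmetric] by simp
    have sq: "(a + t *\<^sub>R v) * (a + t *\<^sub>R v) = a * a + (2 * t) *\<^sub>R (v * a) + (t * t) *\<^sub>R (v * v)" for a
      unfolding 2 by (simp add: algebra_simps)
    have "T (x + t *\<^sub>R v) * T (x + t *\<^sub>R v) \<le> T ((x + t *\<^sub>R v) * (x + t *\<^sub>R v))"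
      by (intro T.schwarz B_add B_scaleR v x)
    moreover have "T (x + t *\<^sub>R v) = T x + t *\<^sub>R v"
      by (simp add: T.add T.scaleR E E_scaleR v)
    ultimately show ?thesis
      unfolding sq 2 by (simp add: sq T.add T.scaleR E E_scaleR E_add T_square[OF v] z_def algebra_simps)
  qed
  have "z \<le> 0"
  proof (rule archimedean)
    fix n
    have "2 * (real (Suc n) / 2) = real (Suc n)" by simp
    with main[of "real (Suc n) / 2"] show "real (Suc n) *\<^sub>R z \<le> T (x * x) - T x * T x"
      by (simp only:)
  qed
  moreover have "- z \<le> 0"
  proof (rule archimedean)
    fix n
    have "2 * (- real (Suc n) / 2) = - real (Suc n)" by simp
    with main[of "- real (Suc n) / 2"] show "real (Suc n) *\<^sub>R - z \<le> T (x * x) - T x * T x"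
      by (simp only: scaleR_minus_left scaleR_minus_right)
  qed
  ultimately have "z = 0" by (metis antisym neg_le_0_iff_le)
  then show ?thesis by (simp add: z_def)
qed

lemma T_mult_T: "x \<in> B \<Longrightarrow> y \<in> B \<Longrightarrow> T (x * T y) = T x * T y"
  using averaging[of "T y" x] by (simp add: T.in_B T_projection B_E mult.commute)

text \<open>The square of \<open>S v - v\<close> has \<open>T\<close>-image at most 0: averaging
  evaluates the mixed terms as \<open>v * v\<close>, and the Schwarz inequality for \<open>S\<close>
  together with \<open>T S = T\<close> bounds the square of \<open>S v\<close>.\<close>

lemma S_fixes_range:
  assumes v: "v \<in> B" "T v = v"
  shows "S v = v"
proof -
  let ?d = "(S v - v) * (S v - v)"
  have E: "v \<in> E" "S v \<in> B" "S v \<in> E" "v * v \<in> B" "v * v \<in> E" "v * S v \<in> E" "S v * S v \<in> E" "?d \<in> E"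
    using v S.in_B by (auto intro: B_E B_mult B_diff)
  have eq: "?d = S v * S v - v * S v - v * S v + v * v" by (simp add: algebra_simps)
  have "T (v * S v) = v * v" using averaging[OF v E(2)] T_S[OF E(1)] v by simp
  then have "T ?d = T (S v * S v) - v * v"
    unfolding eq by (simp add: T.add T.diff E E_diff T_square[OF v])
  also have "T (S v * S v) \<le> T (S (v * v))"
    by (intro T.mono S.schwarz S.in_E E v)
  also have "\<dots> = v * v" using T_S E T_square[OF v] by simp
  finally have "T ?d \<le> 0" by simp
  from T_eq_0[OF E(8) square_nonneg this] have "S v - v = 0" by (rule square_eq_0)
  then show ?thesis by simp
qed

end

section \<open>The ergodic theorem\<close>

context expectation_preserving
begin

lemma S_pow_abs_le: "\<bar>x\<bar> \<le> M *\<^sub>R e \<Longrightarrow> \<bar>(S ^^ k) x\<bar> \<le> M *\<^sub>R e"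
  by (induction k) (auto intro: S.abs_le_unit)

lemma S_pow_in_B: "x \<in> B \<Longrightarrow> (S ^^ k) x \<in> B"
  by (elim BE, rule BI, rule S_pow_abs_le)

lemma S_pow_in_E: "x \<in> E \<Longrightarrow> (S ^^ k) x \<in> E"
  by (induction k) (auto intro: S.in_E)

lemma S_pow_diff: "x \<in> E \<Longrightarrow> y \<in> E \<Longrightarrow> (S ^^ k) (x - y) = (S ^^ k) x - (S ^^ k) y"
  by (induction k) (auto simp: S.diff S_pow_in_E)

lemma S_pow_uminus: "x \<in> E \<Longrightarrow> (S ^^ k) (- x) = - (S ^^ k) x"
  by (induction k) (auto simp: S.uminus S_pow_in_E)

lemma T_S_pow: "x \<in> E \<Longrightarrow> T ((S ^^ k) x) = T x"
  by (induction k) (auto simp: T_S S_pow_in_E)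

lemma S_pow_fixed: "S x = x \<Longrightarrow> (S ^^ k) x = x"
  by (induction k) auto

text \<open>Index \<open>n\<close> stands for \<open>n + 1\<close> iterates, so the divisor never
  vanishes; \<open>averages_converge\<close> divides by \<open>n\<close> instead.\<close>

definition average :: "nat \<Rightarrow> 'a \<Rightarrow> 'a" where
  "average n x = (1 / real (Suc n)) *\<^sub>R (\<Sum>k<Suc n. (S ^^ k) x)"

lemma average_scaleR: "real (Suc n) *\<^sub>R average n x = (\<Sum>k<Suc n. (S ^^ k) x)"
  by (simp add: average_def del: sum.lessThan_Suc)

lemma average_in_E: "x \<in> E \<Longrightarrow> average n x \<in> E"
  unfolding average_def by (intro E_scaleR E_sum S_pow_in_E)

lemma average_uminus: "x \<in> E \<Longrightarrow> average n (- x) = - average n x"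
  unfolding average_def by (simp only: S_pow_uminus sum_negf scaleR_minus_right)

lemma abs_average_le:
  assumes x: "\<bar>x\<bar> \<le> M *\<^sub>R e"
  shows "\<bar>average n x\<bar> \<le> M *\<^sub>R e"
proof -
  have "\<bar>\<Sum>k<Suc n. (S ^^ k) x\<bar> \<le> (\<Sum>k<Suc n. \<bar>(S ^^ k) x\<bar>)" by (rule sum_abs)
  also have "\<dots> \<le> (\<Sum>k<Suc n. M *\<^sub>R e)" by (intro sum_mono S_pow_abs_le x)
  also have "\<dots> = real (Suc n) *\<^sub>R M *\<^sub>R e" by (simp only: sum_constant_scaleR card_lessThan)
  finally have "\<bar>\<Sum>k<Suc n. (S ^^ k) x\<bar> \<le> real (Suc n) *\<^sub>R M *\<^sub>R e" .
  from scaleR_left_mono[OF this, of "1 / real (Suc n)"]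
  show ?thesis unfolding average_def abs_scaleR by simp
qed

lemma average_in_B: "x \<in> B \<Longrightarrow> average n x \<in> B"
  by (elim BE, rule BI, rule abs_average_le)

lemma S_sum: "x \<in> E \<Longrightarrow> S (\<Sum>k<n. (S ^^ k) x) = (\<Sum>k<n. (S ^^ Suc k) x)"
  by (simp add: S.sum S_pow_in_E)

lemma S_average:
  assumes "x \<in> E"
  shows "S (average n x) - average n x = (1 / real (Suc n)) *\<^sub>R ((S ^^ Suc n) x - x)"
proof -
  have "S (average n x) = (1 / real (Suc n)) *\<^sub>R (\<Sum>k<Suc n. (S ^^ Suc k) x)"
    unfolding average_def using assms
    by (simp only: S.scaleR E_sum S_pow_in_E S_sum)
  then have "S (average n x) - average n x =
      (1 / real (Suc n)) *\<^sub>R (\<Sum>k<Suc n. (S ^^ Suc k) x - (S ^^ k) x)"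
    unfolding average_def sum_subtractf scaleR_diff_right by simp
  also have "(\<Sum>k<Suc n. (S ^^ Suc k) x - (S ^^ k) x) = (S ^^ Suc n) x - (S ^^ 0) x"
    by (rule sum_lessThan_telescope)
  finally show ?thesis by simp
qed

text \<open>Telescoping leaves only the first and the last iterate, each bounded by
  \<open>M e\<close>; averages are thus invariant up to a multiple of \<open>e\<close> that tends to
  0.\<close>

lemma average_le_S_average:
  assumes "\<bar>x\<bar> \<le> M *\<^sub>R e"
  shows "average n x \<le> S (average n x) + (1 / real (Suc n)) *\<^sub>R (2 * M) *\<^sub>R e"
proof -
  have E: "x \<in> E" by (rule E_ideal_abs[OF ne_in_E assms])
  have "x - (S ^^ Suc n) x \<le> M *\<^sub>R e + M *\<^sub>R e"
    using assms S_pow_abs_le[OF assms, of "Suc n"] abs_ge_self abs_ge_minus_self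
    unfolding diff_conv_add_uminus by (meson add_mono order_trans)
  also have "\<dots> = (2 * M) *\<^sub>R e" unfolding scaleR_add_left[symmetric] by simp
  finally have "(1 / real (Suc n)) *\<^sub>R (x - (S ^^ Suc n) x) \<le> (1 / real (Suc n)) *\<^sub>R (2 * M) *\<^sub>R e"
    by (rule scaleR_left_mono) simp
  moreover have "average n x - S (average n x) = (1 / real (Suc n)) *\<^sub>R (x - (S ^^ Suc n) x)"
    using S_average[OF E, of n] by (metis minus_diff_eq scaleR_minus_right)
  ultimately have "average n x - S (average n x) \<le> (1 / real (Suc n)) *\<^sub>R (2 * M) *\<^sub>R e" by (simp only:)
  then show ?thesis by (simp only: diff_le_eq add.commute)
qed

text \<open>Garsia's argument.  With \<open>N\<^sub>0 = h\<close> and \<open>N\<^sub>n\<^sub>+\<^sub>1 = h + S N\<^sub>n\<^sup>+\<close>, the element \<open>N\<^sub>n\<close> dominates the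
  first \<open>n + 1\<close> partial sums of \<open>h\<close>, and \<open>h \<ge> N\<^sub>n - S N\<^sub>n\<^sup>+\<close> gives \<open>T h \<ge> - T N\<^sub>n\<^sup>-\<close>.\<close>

lemma maximal_ergodic:
  assumes h: "h \<in> E"
    and unbounded: "\<And>c. 0 \<le> c \<Longrightarrow> (\<And>n. inf c (sup (\<Sum>k<Suc n. (S ^^ k) h) 0) = 0) \<Longrightarrow> c = 0"
  shows "0 \<le> T h"
proof -
  define N where "N = rec_nat h (\<lambda>_ x. h + S (sup x 0))"
  have N0: "N 0 = h" and NS: "\<And>n. N (Suc n) = h + S (sup (N n) 0)" by (simp_all add: N_def)
  have NE: "N n \<in> E" for n
    by (induction n) (auto simp: N0 NS h intro!: E_add S.in_E E_sup E_zero)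
  have pE: "sup (N n) 0 \<in> E" "sup (- N n) 0 \<in> E" for n
    by (auto intro: E_sup E_uminus E_zero NE)
  have N_mono: "N n \<le> N (Suc n)" for n
  proof (induction n)
    case 0
    show ?case using S.nonneg[OF pE(1), of 0] by (simp add: N0 NS)
  next
    case (Suc n)
    have "S (sup (N n) 0) \<le> S (sup (N (Suc n)) 0)"
      by (intro S.mono pE sup_mono Suc order_refl)
    then show ?case unfolding NS[of "Suc n"] by (subst NS) (rule add_left_mono)
  qed
  have N_sum: "(\<Sum>k<Suc n. (S ^^ k) h) \<le> N n" for n
  proof (induction n)
    case 0
    show ?case by (simp add: N0)
  next
    case (Suc n)
    have "(\<Sum>k<Suc (Suc n). (S ^^ k) h) = h + (\<Sum>k<Suc n. (S ^^ Suc k) h)"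
      unfolding sum.lessThan_Suc_shift[of _ "Suc n"] by simp
    also have "\<dots> = h + S (\<Sum>k<Suc n. (S ^^ k) h)"
      by (simp only: S_sum[OF h])
    also have "\<dots> \<le> h + S (sup (N n) 0)"
      by (intro add_left_mono S.mono pE E_sum S_pow_in_E h le_supI1 Suc)
    finally show ?case unfolding NS .
  qed
  \<comment> \<open>A lower bound of these negative parts has a positive part disjoint from the
    positive parts of all partial sums, and the assumption forces it to be 0.\<close>
  have null: "null_seq (\<lambda>n. sup (- N n) 0)"
  proof (rule null_seqI)
    fix c assume c: "\<And>n. c \<le> sup (- N n) 0"
    have "sup c 0 = 0"
    proof (rule unbounded)
      fix n
      let ?s = "\<Sum>k<Suc n. (S ^^ k) h"
      have "sup c 0 \<le> sup (- ?s) 0"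
      proof (rule le_supI)
        have "sup (- N n) 0 \<le> sup (- ?s) 0"
          by (rule sup_mono) (use N_sum[of n] in \<open>auto simp only: neg_le_iff_le order_refl\<close>)
        with c show "c \<le> sup (- ?s) 0" by (rule order_trans)
      qed simp
      moreover have "inf (sup (- ?s) 0) (sup ?s 0) = 0"
        by (subst inf_commute) (rule inf_pos_neg)
      ultimately show "inf (sup c 0) (sup ?s 0) = 0"
        by - (rule disjoint_mono, assumption, rule sup.cobounded2, assumption, rule sup.cobounded2, rule order_refl)
    qed simp
    then show "c \<le> 0" by (metis sup.cobounded1)
  next
    show "sup (- N (Suc n)) 0 \<le> sup (- N n) 0" for n
      by (intro sup_mono order_refl) (simp add: N_mono)
  qed simp
  have "- T h \<le> 0"
  proof (rule null_seqD[OF T.null_seq[OF null pE(2)]])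
    fix n
    have "N n - S (sup (N n) 0) \<le> h" using N_mono[of n] by (simp add: NS diff_le_eq)
    then have "T (N n - S (sup (N n) 0)) \<le> T h"
      by (intro T.mono E_diff NE S.in_E pE h)
    also have "T (N n - S (sup (N n) 0)) = T (N n) - T (sup (N n) 0)"
      by (simp only: T.diff NE S.in_E pE T_S)
    also have "\<dots> = T (N n - sup (N n) 0)" by (simp only: T.diff NE pE)
    also have "N n - sup (N n) 0 = - sup (- N n) 0"
      using pos_diff_neg[of "N n"] by (metis add_uminus_conv_diff diff_add_cancel minus_diff_eq add.commute uminus_add_conv_diff)
    finally show "- T h \<le> T (sup (- N n) 0)"
      unfolding T.uminus[OF pE(2)] by (metis minus_le_iff)
  qed
  then show ?thesis by simp
qed

text \<open>The element \<open>h\<close> is the upper limit of the averages and \<open>H n\<close>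
  their supremum from index \<open>n\<close> on. A one-sided estimate is enough, since
  \<open>- g\<close> supplies the other side.\<close>

lemma average_limsup:
  assumes erg: "ergodic E T S" and g: "g \<in> B"
  shows "\<exists>H h. null_seq (\<lambda>n. H n - h) \<and> h \<in> E \<and> (\<forall>n. H n \<in> E) \<and> h \<le> T g \<and>
    (\<forall>n. average n g \<le> H n)"
proof -
  obtain M where M: "0 \<le> M" "\<bar>g\<bar> \<le> M *\<^sub>R e" using g BE by blast
  have gE: "g \<in> E" using g by (rule B_E)
  have up: "average n g \<le> M *\<^sub>R e" and lo: "- (M *\<^sub>R e) \<le> average n g" for n
    using abs_average_le[OF M(2), of n] abs_ge_self abs_ge_minus_self
    by (blast intro: order_trans, metis minus_le_iff order_trans)
  define H where "H n = (SUP k\<in>{n..}. average k g)" for n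
  have bdd: "bdd_above ((\<lambda>k. average k g) ` {n..})" for n
    using up by (auto intro!: bdd_aboveI[of _ "M *\<^sub>R e"])
  have H_upper: "n \<le> k \<Longrightarrow> average k g \<le> H n" for n k
    unfolding H_def by (rule cSUP_upper[OF _ bdd]) simp
  have H_least: "(\<And>k. n \<le> k \<Longrightarrow> average k g \<le> u) \<Longrightarrow> H n \<le> u" for n u
    unfolding H_def by (rule cSUP_least) auto
  have H_lo: "- (M *\<^sub>R e) \<le> H n" for n using lo H_upper[of n n] by (blast intro: order_trans)
  have H_up: "H n \<le> M *\<^sub>R e" for n by (rule H_least) (rule up)
  have between: "x \<in> E" if "- (M *\<^sub>R e) \<le> x" "x \<le> M *\<^sub>R e" for x
    by (rule E_ideal_abs[OF ne_in_E[of M]], rule abs_leI) (use that in \<open>simp_all add: minus_le_iff\<close>)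
  have HE: "H n \<in> E" for n by (rule between[OF H_lo H_up])
  define h where "h = (INF n. H n)"
  have bddH: "bdd_below (range H)" using H_lo by (auto intro!: bdd_belowI[of _ "- (M *\<^sub>R e)"])
  have h_lower: "h \<le> H n" for n unfolding h_def by (rule cINF_lower[OF bddH]) simp
  have h_greatest: "(\<And>n. u \<le> H n) \<Longrightarrow> u \<le> h" for u unfolding h_def by (rule cINF_greatest) auto
  have hE: "h \<in> E"
    by (rule between[OF h_greatest[OF H_lo] order_trans[OF h_lower[of 0] H_up]])
  have null: "null_seq (\<lambda>n. H n - h)"
  proof (rule null_seqI)
    show "H (Suc n) - h \<le> H n - h" for n by (intro diff_right_mono H_least H_upper) simp
    show "0 \<le> H n - h" for n using h_lower by simp
    fix c assume c: "\<And>n. c \<le> H n - h"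
    have "h + c \<le> h" by (rule h_greatest) (use c in \<open>simp add: algebra_simps\<close>)
    then show "c \<le> 0" by simp
  qed
  \<comment> \<open>Taking suprema in \<open>average_le_S_average\<close> yields
    \<open>h \<le> S h\<close>; since \<open>T\<close> does not see the difference, strict
    positivity turns this into equality.\<close>
  have "h - S h \<le> 0"
  proof (rule null_seqD)
    show "null_seq (\<lambda>n. S (H n - h) + (1 / real (Suc n)) *\<^sub>R (2 * M) *\<^sub>R e)"
      by (intro null_seq_add S.null_seq null E_diff HE hE null_seq_inverse scaleR_nonneg_nonneg e_nonneg)
        (use M in simp)
    fix n
    have "H n \<le> S (H n) + (1 / real (Suc n)) *\<^sub>R (2 * M) *\<^sub>R e"
    proof (rule H_least)
      fix k assume k: "n \<le> k"
      have "average k g \<le> S (average k g) + (1 / real (Suc k)) *\<^sub>R (2 * M) *\<^sub>R e"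
        by (rule average_le_S_average[OF M(2)])
      also have "\<dots> \<le> S (H n) + (1 / real (Suc n)) *\<^sub>R (2 * M) *\<^sub>R e"
        using k M
        by (intro add_mono S.mono average_in_E gE HE H_upper scaleR_right_mono scaleR_nonneg_nonneg e_nonneg)
          (auto simp: frac_le)
      finally show "average k g \<le> S (H n) + (1 / real (Suc n)) *\<^sub>R (2 * M) *\<^sub>R e" .
    qed
    with h_lower[of n] have "h \<le> S (H n) + (1 / real (Suc n)) *\<^sub>R (2 * M) *\<^sub>R e"
      by (rule order_trans)
    then show "h - S h \<le> S (H n - h) + (1 / real (Suc n)) *\<^sub>R (2 * M) *\<^sub>R e"
      unfolding S.diff[OF HE hE] by (simp add: algebra_simps)
  qed
  then have "S h - h = 0"
    by (intro T_eq_0) (auto simp: T.diff S.in_E hE T_S intro: E_diff S.in_E hE)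
  then have Sh: "S h = h" by simp
  with erg hE have Th: "T h = h" unfolding ergodic_def by blast
  have "h - T g \<le> 0"
  proof (rule archimedean_inverse)
    fix m
    define \<epsilon> where "\<epsilon> = 1 / real (Suc m)"
    have \<epsilon>: "0 < \<epsilon>" by (simp add: \<epsilon>_def)
    let ?b = "\<lambda>n. average n g - (h - \<epsilon> *\<^sub>R e)"
    let ?h' = "g - (h - \<epsilon> *\<^sub>R e)"
    have wE: "h - \<epsilon> *\<^sub>R e \<in> E" by (intro E_diff hE ne_in_E)
    have Sw: "S (h - \<epsilon> *\<^sub>R e) = h - \<epsilon> *\<^sub>R e"
      by (simp add: S.diff hE ne_in_E Sh S.scaleR e_in_E S_unit)
    \<comment> \<open>As \<open>h - \<epsilon> e\<close> is invariant, subtracting it from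
      \<open>g\<close> lowers every average by exactly that element.\<close>
    have sum: "(\<Sum>k<Suc n. (S ^^ k) ?h') = real (Suc n) *\<^sub>R ?b n" for n
    proof -
      have "(\<Sum>k<Suc n. (S ^^ k) ?h') = (\<Sum>k<Suc n. (S ^^ k) g - (h - \<epsilon> *\<^sub>R e))"
        by (simp only: S_pow_diff[OF gE wE] S_pow_fixed[OF Sw])
      also have "\<dots> = (\<Sum>k<Suc n. (S ^^ k) g) - real (Suc n) *\<^sub>R (h - \<epsilon> *\<^sub>R e)"
        by (subst sum_subtractf) (simp only: sum_constant_scaleR card_lessThan)
      also have "\<dots> = real (Suc n) *\<^sub>R ?b n"
        by (simp only: average_scaleR scaleR_diff_right[of "real (Suc n)" "average n g" "h - \<epsilon> *\<^sub>R e"])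
      finally show ?thesis .
    qed
    have "0 \<le> T ?h'"
    proof (rule maximal_ergodic)
      show "?h' \<in> E" by (intro E_diff gE wE)
      fix c assume c0: "0 \<le> c" and c: "\<And>n. inf c (sup (\<Sum>k<Suc n. (S ^^ k) ?h') 0) = 0"
      have cb: "inf c (sup (?b n) 0) = 0" for n
      proof -
        have "inf c (real (Suc n) *\<^sub>R sup (?b n) 0) = 0"
          using c[of n] unfolding sum scaleR_sup[OF of_nat_0_le_iff] by simp
        from disjoint_scaleR[OF this, of 1 "1 / real (Suc n)"] show ?thesis by simp
      qed
      \<comment> \<open>The supremum \<open>s\<close> of the positive parts is at least
        \<open>\<epsilon> e\<close>, because the averages have a supremum of at least
        \<open>h\<close>. Hence \<open>c\<close>, being disjoint from \<open>s\<close>, is disjoint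
        from the unit.\<close>
      define s where "s = (SUP n. sup (?b n) 0)"
      have bdds: "bdd_above (range (\<lambda>n. sup (?b n) 0))"
        by (rule bdd_aboveI[of _ "sup (H 0 - (h - \<epsilon> *\<^sub>R e)) 0"])
          (auto simp del: sup.bounded_iff intro!: sup_mono diff_right_mono H_upper)
      have s_upper: "sup (?b n) 0 \<le> s" for n unfolding s_def by (rule cSUP_upper[OF _ bdds]) simp
      have "H 0 \<le> s + (h - \<epsilon> *\<^sub>R e)"
      proof (rule H_least)
        fix k
        have "?b k \<le> s" using s_upper[of k] by (rule order_trans[rotated]) simp
        then show "average k g \<le> s + (h - \<epsilon> *\<^sub>R e)" by (simp only: diff_le_eq)
      qed
      with h_lower[of 0] have "h \<le> s + (h - \<epsilon> *\<^sub>R e)" by (rule order_trans)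
      then have es: "\<epsilon> *\<^sub>R e \<le> s" by (simp add: algebra_simps)
      have "inf c s \<le> 0"
      proof (rule inf_disjoint_Sup_le)
        fix x assume "x \<in> range (\<lambda>n. sup (?b n) 0)"
        then show "inf c x \<le> 0" "x \<le> s" using cb s_upper by auto
      next
        fix u assume u: "\<And>x. x \<in> range (\<lambda>n. sup (?b n) 0) \<Longrightarrow> x \<le> u"
        show "s \<le> u" unfolding s_def by (rule cSUP_least, simp, rule u, rule rangeI)
      qed
      moreover have e0: "0 \<le> \<epsilon> *\<^sub>R e" using \<epsilon> by (intro scaleR_nonneg_nonneg e_nonneg) simp
      ultimately have "inf c (\<epsilon> *\<^sub>R e) = 0"
        using c0 es by (meson antisym inf_greatest inf_mono order_refl order_trans)
      from disjoint_scaleR[OF this, of 1 "1 / \<epsilon>"] \<epsilon> have "inf c e = 0" by simp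
      then show "c = 0" by (rule disjoint_unit)
    qed
    also have "T ?h' = T g - (h - \<epsilon> *\<^sub>R e)"
      by (simp add: T.diff gE wE hE ne_in_E Th T.scaleR e_in_E T_unit)
    finally show "h - T g \<le> (1 / real (Suc m)) *\<^sub>R e"
      unfolding \<epsilon>_def[symmetric] by (simp add: algebra_simps)
  qed
  then have "h \<le> T g" by simp
  with null hE HE H_upper[OF order_refl] show ?thesis by blast
qed

lemma ergodic_theorem:
  assumes erg: "ergodic E T S" and g: "g \<in> B"
  shows "\<exists>X. null_seq X \<and> (\<forall>n. X n \<in> E) \<and> (\<forall>n. \<bar>average n g - T g\<bar> \<le> X n)"
proof -
  have gE: "g \<in> E" using g by (rule B_E)
  have g': "- g \<in> B" using B_scaleR[OF g, of "-1"] by simp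
  obtain H h where H: "null_seq (\<lambda>n. H n - h)" "h \<in> E" "\<And>n. H n \<in> E" "h \<le> T g"
    "\<And>n. average n g \<le> H n"
    using average_limsup[OF erg g] by blast
  obtain H' h' where H': "null_seq (\<lambda>n. H' n - h')" "h' \<in> E" "\<And>n. H' n \<in> E" "h' \<le> - T g"
    "\<And>n. - average n g \<le> H' n"
    using average_limsup[OF erg g'] unfolding average_uminus[OF gE] T.uminus[OF gE] by blast
  have "\<bar>average n g - T g\<bar> \<le> (H n - h) + (H' n - h')" for n
  proof (rule abs_leI)
    have *: "0 \<le> H n - h" "0 \<le> H' n - h'" by (rule null_seq_nonneg[OF H(1)], rule null_seq_nonneg[OF H'(1)])
    have "average n g - T g \<le> H n - h" by (intro diff_mono H)
    also have "\<dots> \<le> (H n - h) + (H' n - h')" using * by (simp only: le_add_same_cancel1)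
    finally show "average n g - T g \<le> (H n - h) + (H' n - h')" .
    have "- average n g - (- T g) \<le> H' n - h'" by (intro diff_mono H')
    also have "\<dots> \<le> (H n - h) + (H' n - h')" using * by (simp only: le_add_same_cancel2)
    finally show "- (average n g - T g) \<le> (H n - h) + (H' n - h')" by (simp only: minus_diff_minus)
  qed
  moreover have "null_seq (\<lambda>n. (H n - h) + (H' n - h'))" by (intro null_seq_add H H')
  moreover have "(H n - h) + (H' n - h') \<in> E" for n by (intro E_add E_diff H H')
  ultimately show ?thesis by blast
qed

text \<open>Since \<open>T (f * T g) = T f * T g\<close>, the error is \<open>T\<close> of
  \<open>f\<close> times the error in the ergodic theorem, and \<open>f\<close> contributes at most
  the factor \<open>M\<close>.\<close>

lemma bounded_mixing:
  assumes erg: "ergodic E T S" and f: "f \<in> B" and g: "g \<in> B"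
  shows "\<exists>X. null_seq X \<and>
    (\<forall>n. \<bar>(1 / real (Suc n)) *\<^sub>R (\<Sum>k<Suc n. T (f * (S ^^ k) g)) - T f * T g\<bar> \<le> X n)"
proof -
  obtain X where X: "null_seq X" "\<And>n. X n \<in> E" "\<And>n. \<bar>average n g - T g\<bar> \<le> X n"
    using ergodic_theorem[OF erg g] by blast
  obtain M where M: "0 \<le> M" "\<bar>f\<bar> \<le> M *\<^sub>R e" using f BE by blast
  have dB: "average n g - T g \<in> B" for n by (intro B_diff average_in_B T.in_B g)
  have "\<bar>(1 / real (Suc n)) *\<^sub>R (\<Sum>k<Suc n. T (f * (S ^^ k) g)) - T f * T g\<bar> \<le> T (M *\<^sub>R X n)" for n
  proof -
    have fE: "f * (S ^^ k) g \<in> E" for k by (intro B_E B_mult f S_pow_in_B g)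
    have "f * average n g = (1 / real (Suc n)) *\<^sub>R (\<Sum>k<Suc n. f * (S ^^ k) g)"
      unfolding average_def sum_distrib_left[symmetric] by simp
    then have "T (f * average n g) = (1 / real (Suc n)) *\<^sub>R (\<Sum>k<Suc n. T (f * (S ^^ k) g))"
      by (simp only: T.scaleR E_sum fE T.sum finite_lessThan)
    moreover have "T (f * average n g) - T f * T g = T (f * (average n g - T g))"
      unfolding right_diff_distrib T_mult_T[OF f g, symmetric]
      by (rule T.diff[symmetric]) (intro B_E B_mult average_in_B T.in_B f g)+
    ultimately have "\<bar>(1 / real (Suc n)) *\<^sub>R (\<Sum>k<Suc n. T (f * (S ^^ k) g)) - T f * T g\<bar>
        = \<bar>T (f * (average n g - T g))\<bar>" by (simp only:)
    also have "\<dots> \<le> T \<bar>f * (average n g - T g)\<bar>" by (intro T.abs_le B_E B_mult f dB)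
    also have "\<dots> \<le> T (M *\<^sub>R X n)"
    proof (intro T.mono E_abs B_E[OF B_mult] f dB E_scaleR X)
      have "\<bar>f * (average n g - T g)\<bar> \<le> \<bar>f\<bar> * \<bar>average n g - T g\<bar>" by (rule abs_le_mult)
      also have "\<dots> \<le> (M *\<^sub>R e) * X n"
        by (intro mult_mono M X scaleR_nonneg_nonneg e_nonneg) auto
      also have "\<dots> = M *\<^sub>R X n" by (simp add: unit)
      finally show "\<bar>f * (average n g - T g)\<bar> \<le> M *\<^sub>R X n" .
    qed
    finally show ?thesis .
  qed
  moreover have "null_seq (\<lambda>n. T (M *\<^sub>R X n))"
    by (intro T.null_seq null_seq_scaleR X M E_scaleR)
  ultimately show ?thesis by blast
qed

end

section \<open>The natural domain\<close>

lemma disjoint_sequence_bounded: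
  fixes a :: "nat \<Rightarrow> 'a::universally_complete_f_algebra"
  assumes "\<And>m n. m \<noteq> n \<Longrightarrow> inf (a m) (a n) = 0" "\<And>n. 0 \<le> a n"
  shows "\<exists>z\<ge>0. \<forall>n. a n \<le> z"
proof -
  have "bdd_above (range a)"
  proof (rule laterally_complete)
    show "0 \<le> x" if "x \<in> range a" for x using that assms(2) by auto
    show "pairwise (\<lambda>x y. inf x y = 0) (range a)"
      unfolding pairwise_def using assms(1) by (metis imageE)
  qed
  then obtain z where "\<And>n. a n \<le> z" by (auto simp: bdd_above_def)
  moreover from this have "0 \<le> z" using assms(2) order_trans by blast
  ultimately show ?thesis by blast
qed

context expectation_preserving
begin

text \<open>Think of \<open>y n\<close> as the truncations of a not yet constructed element.  The tents
  \<open>t n = d n - d (Suc n)\<close> with even index are disjoint, and so are those with odd index, hence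
  lateral completeness bounds \<open>(n + 1) t n\<close>; the remainder is controlled by \<open>d n\<close>, which
  decreases to \<open>0\<close> because \<open>(n + 1) T (d n) \<le> w\<close>.\<close>

lemma truncation_sequence_bounded:
  assumes y: "\<And>m n. m \<le> n \<Longrightarrow> trunc m (y n) = y m" and y0: "\<And>n. 0 \<le> y n"
    and w: "\<And>n. T (y n) \<le> w"
  shows "bdd_above (range y)"
proof -
  define d where "d n = y (Suc n) - y n" for n
  have y_le: "y n \<le> real n *\<^sub>R e" for n using trunc_le_ne[of n "y n"] y[of n n] by simp
  have yE: "y n \<in> E" for n using trunc_in_E[OF y0[of n], of n] y[of n n] by simp
  have y_mono: "m \<le> n \<Longrightarrow> y m \<le> y n" for m n using trunc_le[of m "y n"] y[of m n] by simp
  have y_0: "y 0 = 0" using y_le[of 0] y0[of 0] by (simp add: antisym)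
  have dE: "d n \<in> E" and d0: "0 \<le> d n" for n
    using y_mono[of n "Suc n"] by (auto simp: d_def intro: E_diff yE)
  \<comment> \<open>The increment \<open>d n\<close> is the slice of the element between the heights
    \<open>n e\<close> and \<open>(n + 1) e\<close>.\<close>
  have d_eq: "d n = sup (y (Suc n) - real n *\<^sub>R e) 0" for n
    unfolding d_def y[of n "Suc n", OF le_SucI[OF order_refl], symmetric] trunc_def diff_inf_eq_pos ..
  have Suc_e: "real (Suc n) *\<^sub>R e = real n *\<^sub>R e + e" for n
    using scaleR_add_left[of "real n" 1 e] by (simp add: add.commute)
  have d_le: "d n \<le> e" for n
    unfolding d_eq using y_le[of "Suc n"] e_nonneg unfolding Suc_e by (simp add: diff_le_eq add.commute)
  \<comment> \<open>A slice can be nonzero only where the slice below it is full, that is, equal to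
    \<open>e\<close>.\<close>
  have disj: "inf (e - d n) (d (Suc n)) = 0" for n
  proof (rule disjoint_mono)
    let ?Y = "y (Suc (Suc n))" and ?x = "y (Suc (Suc n)) - real (Suc n) *\<^sub>R e"
    show "inf (sup (- ?x) 0) (sup ?x 0) = 0" by (subst inf_commute) (rule inf_pos_neg)
    have "y (Suc n) - real n *\<^sub>R e \<le> d n" unfolding d_eq by simp
    then have "e - d n \<le> e - (y (Suc n) - real n *\<^sub>R e)" by (rule diff_left_mono)
    also have "\<dots> = real (Suc n) *\<^sub>R e - inf ?Y (real (Suc n) *\<^sub>R e)"
      unfolding y[of "Suc n" "Suc (Suc n)", OF le_SucI[OF order_refl], symmetric] trunc_def Suc_e by simp
    also have "\<dots> = sup (- ?x) 0"
      by (subst inf_commute) (simp only: diff_inf_eq_pos minus_diff_eq)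
    finally show "e - d n \<le> sup (- ?x) 0" .
    show "d (Suc n) \<le> sup ?x 0" unfolding d_eq[of "Suc n"] by (rule order_refl)
  qed (use d0 d_le in auto)
  have d_Suc: "d (Suc n) \<le> d n" for n
  proof -
    have "d (Suc n) - d n \<le> inf (e - d n) (d (Suc n))"
      using d_le[of "Suc n"] d0[of n] by (intro inf_greatest diff_right_mono) simp_all
    then show ?thesis unfolding disj by simp
  qed
  then have d_mono: "m \<le> n \<Longrightarrow> d n \<le> d m" for m n by (rule lift_Suc_antimono_le)
  have sum_d: "(\<Sum>n<N. d n) = y N" for N
    unfolding d_def sum_lessThan_telescope by (simp add: y_0)
  define t where "t n = d n - d (Suc n)" for n
  have t0: "0 \<le> t n" for n using d_Suc by (simp add: t_def)
  have t_disj: "inf (t m) (t n) = 0" if "Suc (Suc m) \<le> n" for m n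
  proof (rule disjoint_mono[OF disj[of "Suc m"]])
    show "t m \<le> e - d (Suc m)" unfolding t_def by (intro diff_right_mono d_le)
    have "t n \<le> d n" using d0[of "Suc n"] by (simp add: t_def)
    also have "\<dots> \<le> d (Suc (Suc m))" using that by (rule d_mono)
    finally show "t n \<le> d (Suc (Suc m))" .
  qed (rule t0)+
  have tents: "\<exists>z\<ge>0. \<forall>n. real (2 * n + i + 1) *\<^sub>R t (2 * n + i) \<le> z" for i
  proof (rule disjoint_sequence_bounded)
    fix m n :: nat assume "m \<noteq> n"
    then have "Suc (Suc (2 * m + i)) \<le> 2 * n + i \<or> Suc (Suc (2 * n + i)) \<le> 2 * m + i" by linarith
    then have "inf (t (2 * m + i)) (t (2 * n + i)) = 0"
      using t_disj by (metis inf_commute)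
    then show "inf (real (2 * m + i + 1) *\<^sub>R t (2 * m + i)) (real (2 * n + i + 1) *\<^sub>R t (2 * n + i)) = 0"
      by (rule disjoint_scaleR) simp_all
  qed (intro scaleR_nonneg_nonneg t0 of_nat_0_le_iff)
  obtain z0 where z0: "0 \<le> z0" "\<And>n. real (2 * n + 0 + 1) *\<^sub>R t (2 * n + 0) \<le> z0" using tents[of 0] by blast
  obtain z1 where z1: "0 \<le> z1" "\<And>n. real (2 * n + 1 + 1) *\<^sub>R t (2 * n + 1) \<le> z1" using tents[of 1] by blast
  have tents_le: "(\<Sum>n<N. real (2 * n + i + 1) *\<^sub>R t (2 * n + i)) \<le> z"
    if "0 \<le> z" "\<And>n. real (2 * n + i + 1) *\<^sub>R t (2 * n + i) \<le> z" for i N z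
  proof (rule disjoint_sum_le)
    fix m n :: nat assume "m \<noteq> n"
    then have "Suc (Suc (2 * m + i)) \<le> 2 * n + i \<or> Suc (Suc (2 * n + i)) \<le> 2 * m + i" by linarith
    then have "inf (t (2 * m + i)) (t (2 * n + i)) = 0"
      using t_disj by (metis inf_commute)
    then show "inf (real (2 * m + i + 1) *\<^sub>R t (2 * m + i)) (real (2 * n + i + 1) *\<^sub>R t (2 * n + i)) = 0"
      by (rule disjoint_scaleR) simp_all
  qed (use that in \<open>auto intro!: scaleR_nonneg_nonneg t0\<close>)
  \<comment> \<open>Abel summation turns the weighted tents into \<open>y N\<close> up to a boundary
    term.\<close>
  have sum_t: "(\<Sum>n<N. real (Suc n) *\<^sub>R t n) = y N - real N *\<^sub>R d N" for N
  proof -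
    have "(\<Sum>n<N. real (Suc n) *\<^sub>R t n) = (\<Sum>n<N. d n) - real N *\<^sub>R d N"
      by (induction N) (simp_all add: t_def scaleR_diff_right algebra_simps)
    then show ?thesis by (simp only: sum_d)
  qed
  have split: "(\<Sum>n<2 * N. f n) = (\<Sum>n<N. f (2 * n + 0)) + (\<Sum>n<N. f (2 * n + 1))" for f :: "nat \<Rightarrow> 'a" and N
    by (induction N) (simp_all add: algebra_simps)
  define z where "z = z0 + z1"
  have z: "0 \<le> z" using z0 z1 by (simp add: z_def)
  have y_even: "y (2 * N) \<le> z + real (2 * N) *\<^sub>R d (2 * N)" for N
  proof -
    have "y (2 * N) - real (2 * N) *\<^sub>R d (2 * N) =
        (\<Sum>n<N. real (2 * n + 0 + 1) *\<^sub>R t (2 * n + 0)) + (\<Sum>n<N. real (2 * n + 1 + 1) *\<^sub>R t (2 * n + 1))"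
      unfolding sum_t[symmetric] split by simp
    also have "\<dots> \<le> z0 + z1" by (intro add_mono tents_le z0 z1)
    finally show ?thesis unfolding z_def by (simp only: diff_le_eq)
  qed
  \<comment> \<open>Because \<open>y k \<le> k e\<close>, the boundary term can be cut off at height
    \<open>k e\<close>. Where it is nonzero the preceding slice is full, so it costs at most
    \<open>k\<close> times that slice. The index \<open>2 * N\<close> is even, as
    \<open>y_even\<close> requires, and lies beyond \<open>k\<close> and \<open>n\<close>.\<close>
  have y_bound: "y k \<le> z + real k *\<^sub>R d n" for k n
  proof -
    define N where "N = Suc (max k n)"
    define M where "M = 2 * N - 1"
    have M: "2 * N = Suc M" "k \<le> Suc M" "n \<le> M" by (auto simp: M_def N_def)
    have MdM: "0 \<le> real (Suc M) *\<^sub>R d (Suc M)" by (intro scaleR_nonneg_nonneg d0) simp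
    have "y k \<le> inf (z + real (Suc M) *\<^sub>R d (Suc M)) (real k *\<^sub>R e)"
      using y_mono[OF M(2)] y_even[of N] y_le[of k] unfolding M(1) by (simp add: order_trans)
    also have "\<dots> \<le> inf (z + real (Suc M) *\<^sub>R d (Suc M)) (z + real k *\<^sub>R e)"
      using z by (intro inf_mono) simp_all
    also have "\<dots> = z + inf (real (Suc M) *\<^sub>R d (Suc M)) (real k *\<^sub>R e)"
      by (simp only: add_inf_distrib_left)
    also have "inf (real (Suc M) *\<^sub>R d (Suc M)) (real k *\<^sub>R e) \<le> real k *\<^sub>R d M"
    proof -
      have "inf (real (Suc M) *\<^sub>R d (Suc M)) (real k *\<^sub>R e) - real k *\<^sub>R d M
          = inf (real (Suc M) *\<^sub>R d (Suc M) - real k *\<^sub>R d M) (real k *\<^sub>R (e - d M))"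
        unfolding inf_diff_right scaleR_diff_right ..
      also have "\<dots> \<le> inf (real (Suc M) *\<^sub>R d (Suc M)) (real k *\<^sub>R (e - d M))"
        by (intro inf_mono order_refl) (simp add: scaleR_nonneg_nonneg d0)
      also have "\<dots> = 0"
        by (rule disjoint_scaleR) (use disj[of M] in \<open>simp_all add: inf_commute\<close>)
      finally show ?thesis by simp
    qed
    also have "real k *\<^sub>R d M \<le> real k *\<^sub>R d n" by (intro scaleR_left_mono d_mono M) simp
    finally show ?thesis by simp
  qed
  have Td: "real (Suc n) *\<^sub>R T (d n) \<le> w" for n
  proof -
    have "real (Suc n) *\<^sub>R d n = (\<Sum>j<Suc n. d n)" by (simp only: sum_constant_scaleR card_lessThan)
    also have "\<dots> \<le> (\<Sum>j<Suc n. d j)" by (intro sum_mono d_mono) simp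
    also have "\<dots> = y (Suc n)" by (rule sum_d)
    finally have "T (real (Suc n) *\<^sub>R d n) \<le> T (y (Suc n))" by (intro T.mono E_scaleR dE yE)
    then show ?thesis unfolding T.scaleR[OF dE] using w order_trans by blast
  qed
  \<comment> \<open>The excess of \<open>y k\<close> over \<open>z\<close> is at most
    \<open>k d n\<close> for every \<open>n\<close>, and \<open>Td\<close> makes the
    \<open>T\<close>-images of these bounds tend to 0.\<close>
  have "y k \<le> z" for k
  proof -
    let ?c = "sup (y k - z) 0"
    have c_le: "?c \<le> y k" using z y0[of k] by simp
    have cE: "?c \<in> E" by (rule E_ideal[OF yE[of k] _ c_le]) simp
    have "T ?c \<le> 0"
    proof (rule archimedean)
      fix n
      have "?c \<le> real k *\<^sub>R d n"
        using y_bound[of k n] by (simp add: diff_le_eq add.commute scaleR_nonneg_nonneg d0)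
      then have "T ?c \<le> real k *\<^sub>R T (d n)"
        using T.mono[OF cE E_scaleR[OF dE]] by (simp add: T.scaleR dE)
      then have "real (Suc n) *\<^sub>R T ?c \<le> real (Suc n) *\<^sub>R real k *\<^sub>R T (d n)"
        by (rule scaleR_left_mono) simp
      also have "\<dots> = real k *\<^sub>R real (Suc n) *\<^sub>R T (d n)" by (simp only: scaleR_left_commute)
      also have "\<dots> \<le> real k *\<^sub>R w" by (intro scaleR_left_mono Td) simp
      finally show "real (Suc n) *\<^sub>R T ?c \<le> real k *\<^sub>R w" .
    qed
    then have "?c = 0" by (intro T_eq_0 cE) simp_all
    then have "y k - z \<le> 0" by (metis sup.cobounded1)
    then show ?thesis by simp
  qed
  then show ?thesis by (intro bdd_aboveI[of _ z]) auto
qed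

section \<open>The extended \<open>S\<close> and its iterates\<close>

lemma S_trunc: "0 \<le> x \<Longrightarrow> m \<le> n \<Longrightarrow> trunc m (S (trunc n x)) = S (trunc m x)"
proof -
  assume x: "0 \<le> x" and mn: "m \<le> n"
  have "trunc m (S (trunc n x)) = inf (S (trunc n x)) (S (real m *\<^sub>R e))"
    by (simp add: trunc_def S.scaleR e_in_E S_unit)
  also have "\<dots> = S (trunc m (trunc n x))"
    unfolding trunc_def[of m] by (rule S_inf[symmetric]) (intro trunc_in_E x ne_in_E)+
  finally show ?thesis using trunc_trunc[OF mn] by simp
qed

text \<open>The elements \<open>S (trunc n x)\<close> are mutually consistent under truncation and
  \<open>T S = T\<close> bounds their \<open>T\<close>-images, so
  \<open>truncation_sequence_bounded\<close> supplies the upper bound needed for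
  \<open>S.ext x\<close> to exist.\<close>

lemma dom_S:
  assumes x: "x \<in> T.dom"
  shows "x \<in> S.dom"
proof -
  have x0: "0 \<le> x" using x by (rule T.dom_nonneg)
  have "bdd_above (range (\<lambda>n. S (trunc n x)))"
  proof (rule truncation_sequence_bounded)
    show "T (S (trunc n x)) \<le> T.ext x" for n
      using T.ext_upper[OF x] by (simp add: T_S trunc_in_E x0)
  qed (auto intro: S_trunc S.nonneg trunc_in_E trunc_nonneg x0)
  with x0 show ?thesis by (simp add: S.dom_def)
qed

lemma trunc_S_ext:
  assumes x: "x \<in> T.dom"
  shows "trunc n (S.ext x) = S (trunc n x)"
proof (rule antisym)
  have x0: "0 \<le> x" using x by (rule T.dom_nonneg)
  note xS = dom_S[OF x]
  have "S (trunc n x) \<le> real n *\<^sub>R e"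
    using trunc_le_ne[of n "S (trunc n x)"] by (simp add: S_trunc x0)
  then show "S (trunc n x) \<le> trunc n (S.ext x)"
    using S.ext_upper[OF xS, of n] by (simp add: trunc_def)
  have "trunc n (S.ext x) - S (trunc n x) \<le> 0"
  proof (rule null_seqD[OF S.ext_null[OF xS]])
    fix m
    let ?k = "max m n"
    have "trunc n (S.ext x) - S (trunc n x) = trunc n (S.ext x) - trunc n (S (trunc ?k x))"
      by (simp add: S_trunc x0)
    also have "\<dots> \<le> S.ext x - S (trunc ?k x)" by (intro trunc_diff_le S.ext_upper xS)
    also have "\<dots> \<le> S.ext x - S (trunc m x)"
      by (intro diff_left_mono S.U_trunc_mono x0) simp_all
    finally show "trunc n (S.ext x) - S (trunc n x) \<le> S.ext x - S (trunc m x)" .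
  qed
  then show "trunc n (S.ext x) \<le> S (trunc n x)" by simp
qed

text \<open>Truncation commutes with the extended \<open>S\<close>, so iterates are computed on
  truncations inside \<open>E\<close>, where \<open>T S = T\<close> holds.\<close>

lemma S_ext_pow:
  assumes x: "x \<in> T.dom"
  shows "(S.ext ^^ k) x \<in> T.dom" and "T.ext ((S.ext ^^ k) x) = T.ext x"
    and "trunc n ((S.ext ^^ k) x) = (S ^^ k) (trunc n x)"
proof -
  have x0: "0 \<le> x" using x by (rule T.dom_nonneg)
  have *: "(S.ext ^^ k) x \<in> T.dom \<and> (\<forall>n. trunc n ((S.ext ^^ k) x) = (S ^^ k) (trunc n x))"
  proof (induction k)
    case 0
    show ?case using x by simp
  next
    case (Suc k)
    let ?y = "(S.ext ^^ k) x"
    from Suc have y: "?y \<in> T.dom" and ty: "\<And>n. trunc n ?y = (S ^^ k) (trunc n x)" by auto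
    have tr: "trunc n (S.ext ?y) = (S ^^ Suc k) (trunc n x)" for n
      by (simp add: trunc_S_ext[OF y] ty)
    have "S.ext ?y \<in> T.dom"
    proof (rule T.domI)
      show "0 \<le> S.ext ?y" by (intro S.ext_nonneg dom_S y)
      show "T (trunc n (S.ext ?y)) \<le> T.ext x" for n
        unfolding tr T_S_pow[OF trunc_in_E[OF x0]] by (rule T.ext_upper[OF x])
    qed
    with tr show ?case by simp
  qed
  then show "(S.ext ^^ k) x \<in> T.dom" and tr: "trunc n ((S.ext ^^ k) x) = (S ^^ k) (trunc n x)" for n
    by auto
  show "T.ext ((S.ext ^^ k) x) = T.ext x"
    unfolding T.ext_def tr T_S_pow[OF trunc_in_E[OF x0]] ..
qed

text \<open>The truncations of \<open>x\<close> form one approximating set; conversely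
  \<open>up_directed_bound\<close> transfers the bound from any other one to them.\<close>

lemma dom_approximating: "x \<in> T.dom \<longleftrightarrow> (\<exists>A. approximating E T A x)"
proof
  assume x: "x \<in> T.dom"
  have x0: "0 \<le> x" using x by (rule T.dom_nonneg)
  have "approximating E T (range (\<lambda>n. trunc n x)) x"
    unfolding approximating_def
  proof (intro conjI)
    show "up_directed (range (\<lambda>n. trunc n x))"
      unfolding up_directed_def
    proof (intro conjI ballI)
      fix a b assume "a \<in> range (\<lambda>n. trunc n x)" "b \<in> range (\<lambda>n. trunc n x)"
      then obtain m n where "a = trunc m x" "b = trunc n x" by blast
      then show "\<exists>c\<in>range (\<lambda>n. trunc n x). a \<le> c \<and> b \<le> c"
        by (intro bexI[of _ "trunc (max m n) x"]) (auto intro: trunc_mono_index)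
    qed simp
    show "is_sup_in UNIV (range (\<lambda>n. trunc n x)) x"
      unfolding is_sup_in_def
    proof (intro conjI ballI impI)
      fix u assume u: "\<forall>a\<in>range (\<lambda>n. trunc n x). a \<le> u"
      have "x - u \<le> 0"
        by (rule null_seqD[OF trunc_null[of x]]) (use u in \<open>auto intro: diff_left_mono\<close>)
      then show "x \<le> u" by simp
    qed (auto simp: trunc_le)
    show "bdd_above (T ` range (\<lambda>n. trunc n x))"
      using x by (simp add: T.dom_def image_image)
  qed (auto simp: trunc_in_E trunc_nonneg x0)
  then show "\<exists>A. approximating E T A x" ..
next
  assume "\<exists>A. approximating E T A x"
  then obtain A where A: "A \<subseteq> E" "\<forall>a\<in>A. 0 \<le> a" "up_directed A" "is_sup_in UNIV A x" "bdd_above (T ` A)"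
    unfolding approximating_def by blast
  from A(5) obtain b where b: "\<And>a. a \<in> A \<Longrightarrow> T a \<le> b" by (auto simp: bdd_above_def)
  show "x \<in> T.dom"
  proof (rule T.domI)
    show "T (trunc n x) \<le> b" for n by (rule T.up_directed_bound[OF A(1-4) b])
    from A(3) obtain a where "a \<in> A" by (auto simp: up_directed_def)
    with A(2,4) show "0 \<le> x" unfolding is_sup_in_def by (meson order_trans)
  qed
qed

lemma natural_domain_pos_eq: "natural_domain_pos E T = T.dom"
  unfolding natural_domain_pos_def using dom_approximating T.dom_nonneg by blast

text \<open>Justifies the definite description in \<open>extend\<close>, with \<open>L\<close>
  standing for \<open>T.ext\<close> or \<open>S.ext\<close>: the value does not depend on the net by
  the first assumption, nor on the representation as a difference by additivity.\<close>

lemma extend_eq: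
  assumes L: "\<And>A x. approximating E T A x \<Longrightarrow> (SUP a\<in>A. U a) = L x"
    and add: "\<And>x y. x \<in> T.dom \<Longrightarrow> y \<in> T.dom \<Longrightarrow> L (x + y) = L x + L y"
    and x: "x \<in> T.dom" and y: "y \<in> T.dom"
  shows "extend E T U (x - y) = L x - L y"
  unfolding extend_def
proof (rule the_equality)
  obtain A B where "approximating E T A x" "approximating E T B y"
    using x y dom_approximating by blast
  then show "\<exists>x' y' A B. x - y = x' - y' \<and> approximating E T A x' \<and> approximating E T B y' \<and>
      L x - L y = (SUP a\<in>A. U a) - (SUP b\<in>B. U b)"
    using L by metis
next
  fix t
  assume "\<exists>x' y' A B. x - y = x' - y' \<and> approximating E T A x' \<and> approximating E T B y' \<and>
      t = (SUP a\<in>A. U a) - (SUP b\<in>B. U b)"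
  then obtain x' y' where *: "x - y = x' - y'" "x' \<in> T.dom" "y' \<in> T.dom" "t = L x' - L y'"
    using L dom_approximating by metis
  from *(1) have "x + y' = x' + y" by (simp add: algebra_simps)
  then have "L x + L y' = L x' + L y" using add x y *(2,3) by metis
  then show "t = L x - L y" unfolding *(4) by (simp add: algebra_simps)
qed

lemma extend_T: "x \<in> T.dom \<Longrightarrow> y \<in> T.dom \<Longrightarrow> extend E T T (x - y) = T.ext x - T.ext y"
proof (rule extend_eq)
  show "(SUP a\<in>A. T a) = T.ext x" if "approximating E T A x" for A x
    using that T.ext_unique[of A x] dom_approximating[of x] unfolding approximating_def by blast
qed (auto simp: T.ext_add)

lemma extend_S: "x \<in> T.dom \<Longrightarrow> y \<in> T.dom \<Longrightarrow> extend E T S (x - y) = S.ext x - S.ext y"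
proof (rule extend_eq)
  show "(SUP a\<in>A. S a) = S.ext x" if "approximating E T A x" for A x
    using that S.ext_unique[of A x] dom_S dom_approximating[of x] unfolding approximating_def by blast
qed (auto simp: S.ext_add dom_S)

section \<open>The spaces of integrable and of bounded elements\<close>

lemma zero_dom: "0 \<in> T.dom"
  by (intro T.dom_E E_zero order_refl)

lemma extend_T_pos: "x \<in> T.dom \<Longrightarrow> extend E T T x = T.ext x"
  using extend_T[OF _ zero_dom, of x] T.ext_E[OF E_zero] by (simp add: T.zero)

lemma extend_S_pow:
  assumes "x \<in> T.dom" "y \<in> T.dom"
  shows "(extend E T S ^^ k) (x - y) = (S.ext ^^ k) x - (S.ext ^^ k) y"
  by (induction k) (simp_all add: extend_S S_ext_pow assms)

lemma L1_eq: "L1 E T = {x - y |x y. x \<in> T.dom \<and> y \<in> T.dom}"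
  unfolding L1_def natural_domain_pos_eq ..

lemma E_eq_extend_T: "x \<in> E \<Longrightarrow> 0 \<le> x \<Longrightarrow> extend E T T x = T x"
  by (simp add: extend_T_pos T.dom_E T.ext_E)

lemma L1_parts:
  assumes "f \<in> L1 E T"
  shows "sup f 0 \<in> T.dom" "sup (- f) 0 \<in> T.dom"
proof -
  obtain x y where xy: "f = x - y" "x \<in> T.dom" "y \<in> T.dom" using assms by (auto simp: L1_eq)
  have 0: "0 \<le> x" "0 \<le> y" using xy by (auto intro: T.dom_nonneg)
  show "sup f 0 \<in> T.dom" by (rule T.dom_mono[OF xy(2)]) (use 0 xy(1) in auto)
  show "sup (- f) 0 \<in> T.dom" by (rule T.dom_mono[OF xy(3)]) (use 0 xy(1) in auto)
qed

lemma Linf_bound: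
  assumes "f \<in> Linf E T"
  obtains w where "w \<in> T.dom" "\<bar>f\<bar> \<le> T.ext w"
proof -
  obtain u where u: "u \<in> L1 E T" "\<bar>f\<bar> \<le> extend E T T u"
    using assms unfolding Linf_def by blast
  then obtain x y where xy: "u = x - y" "x \<in> T.dom" "y \<in> T.dom" by (auto simp: L1_eq)
  \<comment> \<open>Dropping the positive element \<open>T.ext y\<close> replaces the bound by the
    image of a positive element.\<close>
  have "extend E T T u \<le> T.ext x"
    using T.ext_nonneg[OF xy(3)] by (simp add: xy extend_T)
  with u(2) have "\<bar>f\<bar> \<le> T.ext x" by (rule order_trans)
  with xy(2) that show thesis by blast
qed

lemma E_subset_L1: "E \<subseteq> L1 E T"
proof
  fix x assume x: "x \<in> E"
  have "sup x 0 \<in> T.dom" "sup (- x) 0 \<in> T.dom"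
    using x by (auto intro!: T.dom_E E_sup E_uminus E_zero)
  then show "x \<in> L1 E T" unfolding L1_eq using pos_diff_neg[of x] by (metis (mono_tags, lifting) mem_Collect_eq)
qed

lemma B_subset_Linf: "B \<subseteq> Linf E T"
proof
  fix f assume f: "f \<in> B"
  obtain M where M: "0 \<le> M" "\<bar>f\<bar> \<le> M *\<^sub>R e" using f BE by blast
  have "extend E T T (M *\<^sub>R e) = M *\<^sub>R e"
    using M by (subst E_eq_extend_T) (auto simp: T.scaleR e_in_E T_unit ne_in_E intro!: scaleR_nonneg_nonneg e_nonneg)
  then have "M *\<^sub>R e \<in> extend E T T ` L1 E T"
    using ne_in_E[of M] E_subset_L1 by (metis image_eqI subsetD)
  with M(2) show "f \<in> Linf E T"
    unfolding Linf_def using E_subset_L1 B_E[OF f] by blast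
qed

end

section \<open>Mixing in the mean\<close>

context expectation_preserving
begin

text \<open>The averaging property, in the form of an inequality, beyond bounded elements. The
  products of \<open>T (trunc n w)\<close> and \<open>trunc n y\<close> are bounded, obey
  \<open>averaging\<close>, and increase to \<open>T.ext w * y\<close>; order continuity passes
  their common bound on to the truncations of that limit.\<close>

lemma dom_mult:
  assumes w: "w \<in> T.dom" and y: "y \<in> T.dom" and h: "0 \<le> h" "h \<le> T.ext w"
  shows "h * y \<in> T.dom" and "T.ext (h * y) \<le> T.ext w * T.ext y"
proof -
  define u where "u = T.ext w"
  have w0: "0 \<le> w" and y0: "0 \<le> y" and u0: "0 \<le> u"
    using w y T.ext_nonneg[OF w] by (auto simp: u_def intro: T.dom_nonneg)
  let ?p = "\<lambda>n. T (trunc n w) * trunc n y"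
  have tw0: "0 \<le> T (trunc n w)" for n by (intro T.nonneg trunc_in_E trunc_nonneg w0)
  have tu: "T (trunc n w) \<le> u" for n unfolding u_def by (rule T.ext_upper[OF w])
  have p_mono: "?p n \<le> ?p (Suc n)" for n
    by (intro mult_mono T.U_trunc_mono trunc_mono_index tw0 trunc_nonneg w0 y0) simp_all
  have p_le: "?p n \<le> u * y" for n
    by (intro mult_mono tu trunc_le u0 trunc_nonneg y0)
  have p_null: "null_seq (\<lambda>n. u * y - ?p n)"
  proof (rule null_seq_le)
    show "null_seq (\<lambda>n. y * (u - T (trunc n w)) + u * (y - trunc n y))"
      unfolding u_def
      by (intro null_seq_add null_seq_mult T.ext_null w trunc_null y0 T.ext_nonneg)
    fix n
    have "u * y - ?p n = y * (u - T (trunc n w)) + T (trunc n w) * (y - trunc n y)"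
      by (simp add: algebra_simps)
    also have "\<dots> \<le> y * (u - T (trunc n w)) + u * (y - trunc n y)"
      by (intro add_left_mono mult_right_mono tu) (simp add: trunc_le)
    finally show "u * y - ?p n \<le> y * (u - T (trunc n w)) + u * (y - trunc n y)" .
  qed (use p_mono p_le in \<open>auto intro: diff_left_mono\<close>)
  have uy0: "0 \<le> u * y" by (intro mult_nonneg_nonneg u0 y0)
  have p0: "0 \<le> ?p n" for n by (intro mult_nonneg_nonneg tw0 trunc_nonneg y0)
  have bound: "T (trunc m (u * y)) \<le> u * T.ext y" for m
  proof -
    have qE: "trunc m (u * y) - trunc m (?p n) \<in> E" for n
      by (intro E_diff trunc_in_E uy0 p0)
    have "null_seq (\<lambda>n. trunc m (u * y) - trunc m (?p n))"
      by (rule null_seq_le[OF p_null])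
        (use p_mono p_le in \<open>auto intro!: diff_left_mono trunc_mono trunc_diff_le\<close>)
    from T.null_seq[OF this qE] have "T (trunc m (u * y)) - u * T.ext y \<le> 0"
    proof (rule null_seqD)
      fix n
      have "T (trunc m (?p n)) \<le> T (?p n)"
        by (intro T.mono trunc_in_E trunc_le p0 B_E B_mult T.in_B trunc_in_B w0 y0)
      also have "\<dots> = T (trunc n w) * T (trunc n y)"
        by (intro averaging T.in_B trunc_in_B w0 y0 T_projection trunc_in_E)
      also have "\<dots> \<le> u * T.ext y"
        by (intro mult_mono tu T.ext_upper y u0 T.nonneg trunc_in_E trunc_nonneg y0)
      finally show "T (trunc m (u * y)) - u * T.ext y \<le> T (trunc m (u * y) - trunc m (?p n))"
        by (simp add: T.diff trunc_in_E uy0 p0)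
    qed
    then show ?thesis by simp
  qed
  have uy: "u * y \<in> T.dom" by (rule T.domI[OF uy0 bound])
  have hy: "0 \<le> h * y" "h * y \<le> u * y"
    using h y0 by (auto intro: mult_nonneg_nonneg mult_right_mono simp: u_def)
  show "h * y \<in> T.dom" by (rule T.dom_mono[OF uy hy])
  have "T.ext (h * y) \<le> T.ext (u * y)" by (rule T.ext_mono[OF uy hy])
  also have "\<dots> \<le> u * T.ext y" by (rule T.ext_least[OF bound])
  finally show "T.ext (h * y) \<le> T.ext w * T.ext y" unfolding u_def .
qed

text \<open>Truncating \<open>f\<close> at height \<open>j\<close> and \<open>x\<close> at height
  \<open>m\<close> reduces the claim to \<open>bounded_mixing\<close>, at the cost of an error
  \<open>R j m\<close> that does not depend on \<open>n\<close>.\<close>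

lemma mixing_pos:
  assumes erg: "ergodic E T S"
    and w: "w \<in> T.dom" and f: "f \<in> T.dom" "f \<le> T.ext w" and x: "x \<in> T.dom"
  shows "order_tendsto (\<lambda>n. (1 / real n) *\<^sub>R (\<Sum>k<n. T.ext (f * (S.ext ^^ k) x)))
    (T.ext f * T.ext x) sequentially"
proof -
  define u F G where "u = T.ext w" and "F = T.ext f" and "G = T.ext x"
  define b where "b n = (1 / real n) *\<^sub>R (\<Sum>k<n. T.ext (f * (S.ext ^^ k) x))" for n
  have f0: "0 \<le> f" and x0: "0 \<le> x" using f x by (auto intro: T.dom_nonneg)
  have u0: "0 \<le> u" and F0: "0 \<le> F" and G0: "0 \<le> G"
    using w f x by (auto simp: u_def F_def G_def intro: T.ext_nonneg)
  \<comment> \<open>In each coefficient the first summand comes from truncating inside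
    \<open>T\<close>, the second from replacing the limit \<open>F * G\<close> by the product of the
    truncated images.\<close>
  define R where "R j m = (real m *\<^sub>R e + G) * (F - T (trunc j f)) + (u + F) * (G - T (trunc m x))" for j m
  have term_bound: "\<bar>T.ext (f * (S.ext ^^ k) x) - T (trunc j f * (S ^^ k) (trunc m x))\<bar>
      \<le> real m *\<^sub>R (F - T (trunc j f)) + u * (G - T (trunc m x))" for j k m
  proof -
    let ?p = "(S.ext ^^ k) x" and ?fj = "trunc j f"
    have p: "?p \<in> T.dom" "T.ext ?p = G" "trunc m ?p = (S ^^ k) (trunc m x)"
      using S_ext_pow[OF x] by (auto simp: G_def)
    let ?pm = "trunc m ?p"
    have p0: "0 \<le> ?p" by (rule T.dom_nonneg[OF p(1)])
    have pm: "0 \<le> ?pm" "?pm \<le> ?p" "?pm \<le> real m *\<^sub>R e" by (auto simp: trunc_nonneg p0 trunc_le trunc_le_ne)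
    have fj: "0 \<le> ?fj" "?fj \<le> f" by (auto simp: trunc_nonneg f0 trunc_le)
    have me: "real m *\<^sub>R e \<in> T.dom" "T.ext (real m *\<^sub>R e) = real m *\<^sub>R e"
      by (auto simp: T.dom_E T.ext_E ne_in_E ne_nonneg T.scaleR e_in_E T_unit)
    have fd: "f - ?fj \<in> T.dom" by (rule T.dom_mono[OF f(1)]) (use fj in auto)
    have pd: "?p - ?pm \<in> T.dom" by (rule T.dom_mono[OF p(1)]) (use pm in auto)
    have pmle: "?pm \<le> T.ext (real m *\<^sub>R e)" unfolding me(2) by (rule pm(3))
    note 1 = dom_mult[OF me(1) fd pm(1) pmle]
    note 2 = dom_mult[OF w pd f0 f(2)]
    have prodE: "?fj * ?pm \<in> E" "0 \<le> ?fj * ?pm"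
      by (intro B_E B_mult trunc_in_B f0 p0, intro mult_nonneg_nonneg fj pm)
    \<comment> \<open>The product is split so that each error keeps a bounded factor:
      \<open>?pm\<close> is below \<open>m e\<close> and \<open>f\<close> is below \<open>u\<close>,
      and \<open>dom_mult\<close> applies to both.\<close>
    have "f * ?p = ?fj * ?pm + (?pm * (f - ?fj) + f * (?p - ?pm))" by (simp add: algebra_simps)
    then have "T.ext (f * ?p) = T (?fj * ?pm) + (T.ext (?pm * (f - ?fj)) + T.ext (f * (?p - ?pm)))"
      using 1 2 prodE by (simp add: T.ext_add T.dom_add T.dom_E T.ext_E)
    then have eq: "T.ext (f * ?p) - T (?fj * ?pm) = T.ext (?pm * (f - ?fj)) + T.ext (f * (?p - ?pm))"
      by simp
    have "T.ext (?pm * (f - ?fj)) \<le> real m *\<^sub>R (F - T ?fj)"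
      using 1(2) T.ext_diff[OF f(1) fj] fj
      by (simp add: me unit F_def T.ext_E trunc_in_E f0)
    moreover have "T.ext (f * (?p - ?pm)) \<le> u * (G - T (trunc m x))"
      using 2(2) T.ext_diff[OF p(1) pm(1,2)] pm
      by (simp add: p(2) u_def T.ext_E trunc_in_E p0) (simp add: p(3) T_S_pow trunc_in_E x0)
    moreover have "0 \<le> T.ext (?pm * (f - ?fj))" "0 \<le> T.ext (f * (?p - ?pm))"
      using 1(1) 2(1) by (auto intro: T.ext_nonneg)
    ultimately have "\<bar>T.ext (f * ?p) - T (?fj * ?pm)\<bar> \<le> real m *\<^sub>R (F - T ?fj) + u * (G - T (trunc m x))"
      unfolding eq by (simp only: abs_of_nonneg add_nonneg_nonneg add_mono)
    then show ?thesis unfolding p(3) .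
  qed
  have main: "\<exists>X. null_seq X \<and> (\<forall>n. \<bar>b (Suc n) - F * G\<bar> \<le> X n + R j m)" for j m
  proof -
    let ?f = "trunc j f" and ?x = "trunc m x"
    obtain X where X: "null_seq X"
      "\<And>n. \<bar>(1 / real (Suc n)) *\<^sub>R (\<Sum>k<Suc n. T (?f * (S ^^ k) ?x)) - T ?f * T ?x\<bar> \<le> X n"
      using bounded_mixing[OF erg trunc_in_B[OF f0, of j] trunc_in_B[OF x0, of m]] by blast
    have "\<bar>b (Suc n) - F * G\<bar> \<le> X n + R j m" for n
    proof -
      define c where "c = (1 / real (Suc n)) *\<^sub>R (\<Sum>k<Suc n. T (?f * (S ^^ k) ?x))"
      let ?r = "real m *\<^sub>R (F - T ?f) + u * (G - T ?x)"
      have "b (Suc n) - c = (1 / real (Suc n)) *\<^sub>R (\<Sum>k<Suc n. T.ext (f * (S.ext ^^ k) x) - T (?f * (S ^^ k) ?x))"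
        unfolding b_def c_def sum_subtractf scaleR_diff_right ..
      moreover have "\<bar>\<Sum>k<Suc n. T.ext (f * (S.ext ^^ k) x) - T (?f * (S ^^ k) ?x)\<bar> \<le> real (Suc n) *\<^sub>R ?r"
      proof -
        have "\<bar>\<Sum>k<Suc n. T.ext (f * (S.ext ^^ k) x) - T (?f * (S ^^ k) ?x)\<bar> \<le> (\<Sum>k<Suc n. ?r)"
          by (rule order_trans[OF sum_abs sum_mono]) (rule term_bound)
        then show ?thesis by (simp only: sum_constant_scaleR card_lessThan)
      qed
      from scaleR_left_mono[OF this, of "1 / real (Suc n)"]
      have "(1 / real (Suc n)) *\<^sub>R \<bar>\<Sum>k<Suc n. T.ext (f * (S.ext ^^ k) x) - T (?f * (S ^^ k) ?x)\<bar> \<le> ?r"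
        by (simp del: sum.lessThan_Suc)
      ultimately have 1: "\<bar>b (Suc n) - c\<bar> \<le> ?r"
        by (simp only: abs_scaleR) (simp del: sum.lessThan_Suc)
      have 2: "\<bar>c - T ?f * T ?x\<bar> \<le> X n" unfolding c_def by (rule X(2))
      have Tf: "0 \<le> F - T ?f" "0 \<le> G - T ?x" "0 \<le> T ?x" "T ?x \<le> G"
        using T.ext_upper f x by (auto simp: F_def G_def intro!: T.nonneg trunc_in_E trunc_nonneg x0)
      have "F * G - T ?f * T ?x = G * (F - T ?f) + T ?f * (G - T ?x)" by (simp add: algebra_simps)
      moreover have "0 \<le> G * (F - T ?f)" "0 \<le> T ?f * (G - T ?x)" "T ?f * (G - T ?x) \<le> F * (G - T ?x)"
        using Tf G0 by (auto intro!: mult_nonneg_nonneg mult_right_mono T.nonneg trunc_in_E trunc_nonneg f0)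
      ultimately have 3: "\<bar>T ?f * T ?x - F * G\<bar> \<le> G * (F - T ?f) + F * (G - T ?x)"
        by (subst abs_minus_commute) (simp only: abs_of_nonneg add_nonneg_nonneg add_left_mono)
      have "\<bar>b (Suc n) - F * G\<bar> = \<bar>(b (Suc n) - c) + (c - T ?f * T ?x) + (T ?f * T ?x - F * G)\<bar>"
        by simp
      also have "\<dots> \<le> \<bar>b (Suc n) - c\<bar> + \<bar>c - T ?f * T ?x\<bar> + \<bar>T ?f * T ?x - F * G\<bar>"
        by (rule order_trans[OF abs_triangle_ineq add_right_mono[OF abs_triangle_ineq]])
      also have "\<dots> \<le> ?r + X n + (G * (F - T ?f) + F * (G - T ?x))"
        by (intro add_mono 1 2 3)
      also have "\<dots> = X n + R j m"
        unfolding R_def distrib_right mult_scaleR_left unit by (simp add: add_ac)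
      finally show ?thesis .
    qed
    with X(1) show ?thesis by blast
  qed
  have "order_tendsto b (F * G) sequentially"
  proof -
    have ev: "\<forall>\<^sub>F n in sequentially. \<bar>b n - F * G\<bar> \<le> X N + R j m"
      if "null_seq X" "\<forall>n. \<bar>b (Suc n) - F * G\<bar> \<le> X n + R j m" for X N j m
      unfolding eventually_sequentially
    proof (intro exI[of _ "Suc N"] allI impI)
      fix n assume "Suc N \<le> n"
      then obtain n' where n': "n = Suc n'" "N \<le> n'" by (cases n) auto
      have "\<bar>b n - F * G\<bar> \<le> X n' + R j m" using that(2) n' by simp
      also have "\<dots> \<le> X N + R j m" by (intro add_right_mono null_seq_antimono that n')
      finally show "\<bar>b n - F * G\<bar> \<le> X N + R j m" .
    qed
    obtain X where X: "null_seq X" "\<forall>n. \<bar>b (Suc n) - F * G\<bar> \<le> X n + R 0 0" using main by blast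
    show ?thesis
    proof (rule order_tendstoI[OF ev[OF X, of 0]])
      fix c assume c: "\<And>y. \<forall>\<^sub>F n in sequentially. \<bar>b n - F * G\<bar> \<le> y \<Longrightarrow> c \<le> y"
      \<comment> \<open>The limit in \<open>n\<close> comes first. Then \<open>j\<close> grows with
        \<open>m\<close> fixed, because \<open>m\<close> is a factor of the error caused by
        \<open>j\<close>; \<open>m\<close> grows last.\<close>
      have cR: "c \<le> R j m" for j m
      proof -
        obtain X where X: "null_seq X" "\<forall>n. \<bar>b (Suc n) - F * G\<bar> \<le> X n + R j m" using main by blast
        have "c - R j m \<le> 0"
          by (rule null_seqD[OF X(1)]) (use c[OF ev[OF X]] in \<open>simp add: diff_le_eq\<close>)
        then show ?thesis by simp
      qed
      have "c \<le> (u + F) * (G - T (trunc m x))" for m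
      proof -
        have "0 \<le> real m *\<^sub>R e + G" by (intro add_nonneg_nonneg ne_nonneg G0)
        from null_seq_mult[OF T.ext_null[OF f(1)] this]
        have "c - (u + F) * (G - T (trunc m x)) \<le> 0"
          by (rule null_seqD) (use cR in \<open>simp add: R_def F_def diff_le_eq\<close>)
        then show ?thesis by simp
      qed
      then show "c \<le> 0"
        by (intro null_seqD[OF null_seq_mult[OF T.ext_null[OF x] add_nonneg_nonneg[OF u0 F0]]])
          (simp add: G_def)
    qed
  qed
  then show ?thesis unfolding b_def F_def G_def .
qed

text \<open>Both sides are bilinear, so positive and negative parts reduce the claim to four
  instances of \<open>mixing_pos\<close>.\<close>

lemma mixing:
  assumes erg: "ergodic E T S" and f: "f \<in> Linf E T" and g: "g \<in> L1 E T"
  shows "averages_converge E T S f g"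
proof -
  obtain w where w: "w \<in> T.dom" "\<bar>f\<bar> \<le> T.ext w" using f by (rule Linf_bound)
  have fL: "f \<in> L1 E T" using f by (simp add: Linf_def)
  define f1 f2 g1 g2 where "f1 = sup f 0" and "f2 = sup (- f) 0" and "g1 = sup g 0" and "g2 = sup (- g) 0"
  have fg: "f = f1 - f2" "g = g1 - g2"
    unfolding f1_def f2_def g1_def g2_def by (rule pos_diff_neg[symmetric])+
  have dom: "f1 \<in> T.dom" "f2 \<in> T.dom" "g1 \<in> T.dom" "g2 \<in> T.dom"
    unfolding f1_def f2_def g1_def g2_def by (intro L1_parts fL g)+
  have le: "f1 \<le> T.ext w" "f2 \<le> T.ext w"
    unfolding f1_def f2_def by (rule order_trans[OF pos_le_abs(1) w(2)], rule order_trans[OF pos_le_abs(2) w(2)])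
  have d: "h * (S.ext ^^ k) y \<in> T.dom" if "h \<in> T.dom" "h \<le> T.ext w" "y \<in> T.dom" for h y k
    by (rule dom_mult(1)[OF w(1) S_ext_pow(1)[OF that(3)] T.dom_nonneg[OF that(1)] that(2)])
  note dd = d[OF dom(1) le(1) dom(3)] d[OF dom(1) le(1) dom(4)] d[OF dom(2) le(2) dom(3)] d[OF dom(2) le(2) dom(4)]
  have summand: "extend E T T (f * (extend E T S ^^ k) g) =
      (T.ext (f1 * (S.ext ^^ k) g1) + T.ext (f2 * (S.ext ^^ k) g2)) -
      (T.ext (f1 * (S.ext ^^ k) g2) + T.ext (f2 * (S.ext ^^ k) g1))" for k
  proof -
    have "f * (extend E T S ^^ k) g = (f1 * (S.ext ^^ k) g1 + f2 * (S.ext ^^ k) g2) -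
        (f1 * (S.ext ^^ k) g2 + f2 * (S.ext ^^ k) g1)"
      unfolding fg(2) extend_S_pow[OF dom(3,4)] unfolding fg(1) by (simp add: algebra_simps)
    then show ?thesis by (simp only: extend_T T.dom_add dd T.ext_add)
  qed
  have lim: "extend E T T f * extend E T T g = (T.ext f1 * T.ext g1 + T.ext f2 * T.ext g2) -
      (T.ext f1 * T.ext g2 + T.ext f2 * T.ext g1)"
    unfolding fg extend_T[OF dom(1,2)] extend_T[OF dom(3,4)] by (simp add: algebra_simps)
  show ?thesis
    unfolding averages_converge_def summand lim sum_subtractf sum.distrib scaleR_diff_right scaleR_add_right
    by (intro order_tendsto_add order_tendsto_diff mixing_pos[OF erg w(1)] dom le)
qed


section \<open>Ergodicity from mixing of components\<close>

lemma component_square: "p \<in> components_of E e \<Longrightarrow> p * p = p"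
  using disjoint_mult_eq_0[of p "e - p"] by (simp add: components_of_def right_diff_distrib unit_right)

lemma component_bounds:
  assumes "p \<in> components_of E e"
  shows "0 \<le> p" "p \<le> e"
proof -
  have "inf p (e - p) = 0" using assms by (simp add: components_of_def)
  then have "0 \<le> p" "0 \<le> e - p" by (metis inf.cobounded1, metis inf.cobounded2)
  then show "0 \<le> p" "p \<le> e" by simp_all
qed

lemma components_subset_B: "components_of E e \<subseteq> B"
  by (auto intro: B_between[OF B_e] component_bounds)

lemma invariant_component:
  assumes p: "p \<in> components_of E e" "S p = p" and conv: "averages_converge E T S p p"
  shows "T p = p"
proof -
  have pE: "p \<in> E" and p0: "0 \<le> p" and pB: "p \<in> B"
    using p(1) component_bounds components_subset_B by (auto simp: components_of_def)
  have ext_T: "extend E T T p = T p" by (rule E_eq_extend_T[OF pE p0])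
  have "extend E T S p = p"
    using extend_S[OF T.dom_E[OF pE p0] zero_dom] p(2)
    by (simp add: S.ext_E pE p0 E_zero S.zero)
  then have pow: "(extend E T S ^^ k) p = p" for k by (induction k) auto
  have "T p = T p * T p"
  proof (rule order_tendsto_const_unique)
    show "order_tendsto (\<lambda>n. (1 / real n) *\<^sub>R (\<Sum>k<n. extend E T T (p * (extend E T S ^^ k) p)))
        (T p * T p) sequentially"
      using conv unfolding averages_converge_def ext_T .
    \<comment> \<open>The value at \<open>n = 0\<close> is 0 by convention, so equality is claimed
      only from index 1 on.\<close>
    show "\<forall>\<^sub>F n in sequentially. (1 / real n) *\<^sub>R (\<Sum>k<n. extend E T T (p * (extend E T S ^^ k) p)) = T p"
      using eventually_gt_at_top[of "0::nat"]
      by eventually_elim (simp add: pow component_square[OF p(1)] ext_T sum_constant_scaleR)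
  qed
  then have TT: "T p * T p = T p" by simp
  have B: "T p \<in> B" by (rule T.in_B[OF pB])
  have E: "T p \<in> E" "p * T p \<in> E" by (intro T.in_E pE, intro B_E B_mult pB B)
  \<comment> \<open>Both \<open>p\<close> and \<open>T p\<close> are idempotent, which removes the
    squares; \<open>T_mult_T\<close> evaluates the image of the mixed term as \<open>T p\<close> as
    well.\<close>
  have "(p - T p) * (p - T p) = p - p * T p - p * T p + T p"
    by (simp add: algebra_simps TT component_square[OF p(1)])
  then have "T ((p - T p) * (p - T p)) = T p - T (p * T p) - T (p * T p) + T (T p)"
    by (simp add: T.add T.diff E E_diff E_add pE)
  also have "\<dots> = 0" by (simp add: T_mult_T pB TT T_projection pE)
  finally have "(p - T p) * (p - T p) = 0"
    by (intro T_eq_0 B_E B_mult B_diff pB B square_nonneg) simp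
  then have "p - T p = 0" by (rule square_eq_0)
  then show ?thesis by simp
qed

lemma T_eq_if_le:
  assumes "f \<in> E" "f \<le> T f"
  shows "T f = f"
proof -
  have "T f - f = 0"
    by (rule T_eq_0) (use assms in \<open>auto intro: E_diff T.in_E simp: T.diff T.in_E T_projection\<close>)
  then show ?thesis by simp
qed

text \<open>The carrier of the positive part is the supremum of its multiples cut off at
  \<open>e\<close>. Each \<open>q n\<close> is invariant, and order continuity of \<open>S\<close>
  passes this on to the supremum \<open>p\<close>.\<close>

lemma invariant_carrier:
  assumes x: "x \<in> E" "S x = x"
  shows "\<exists>p. p \<in> components_of E e \<and> S p = p \<and> p * x = sup x 0"
proof -
  let ?x = "sup x 0" and ?n = "sup (- x) 0"
  have xE: "?x \<in> E" by (intro E_sup x E_zero)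
  have Sx: "S ?x = ?x" using S_sup[OF x(1) E_zero] by (simp add: x(2) S.zero)
  define q where "q n = inf (real n *\<^sub>R ?x) e" for n
  have nx0: "0 \<le> real n *\<^sub>R ?x" for n by (intro scaleR_nonneg_nonneg) simp_all
  have q0: "0 \<le> q n" and qe: "q n \<le> e" and qx: "q n \<le> real n *\<^sub>R ?x" for n
    using nx0[of n] e_nonneg by (auto simp: q_def simp del: sup.bounded_iff)
  have qE: "q n \<in> E" for n unfolding q_def by (intro E_inf E_scaleR xE e_in_E)
  have Sq: "S (q n) = q n" for n
    unfolding q_def by (simp add: S_inf E_scaleR xE e_in_E S.scaleR Sx S_unit)
  have q_mono: "m \<le> n \<Longrightarrow> q m \<le> q n" for m n
    unfolding q_def by (intro inf_mono scaleR_right_mono order_refl) simp_all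
  define p where "p = (SUP n. q n)"
  have bdd: "bdd_above (range q)" using qe by (intro bdd_aboveI[of _ e]) auto
  have q_le_p: "q n \<le> p" for n unfolding p_def by (rule cSUP_upper[OF _ bdd]) simp
  have p_least: "(\<And>n. q n \<le> u) \<Longrightarrow> p \<le> u" for u unfolding p_def by (rule cSUP_least) auto
  have p_le_e: "p \<le> e" by (rule p_least[OF qe])
  have p0: "0 \<le> p" using q0 q_le_p order_trans by blast
  have pE: "p \<in> E" by (rule E_ideal[OF e_in_E p0 p_le_e])
  have null: "null_seq (\<lambda>n. p - q n)"
  proof (rule null_seqI)
    fix c assume c: "\<And>n. c \<le> p - q n"
    have "p \<le> p - c"
    proof (rule p_least)
      fix n show "q n \<le> p - c" using c[of n] by (simp add: algebra_simps)
    qed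
    then show "c \<le> 0" by simp
  qed (auto intro: diff_left_mono q_mono simp: q_le_p)
  have "S p - p \<le> 0"
  proof (rule null_seqD[OF S.null_seq[OF null]])
    show "p - q n \<in> E" for n by (intro E_diff pE qE)
    show "S p - p \<le> S (p - q n)" for n
      using q_le_p[of n] by (simp add: S.diff pE qE Sq diff_left_mono)
  qed
  moreover have "p \<le> S p"
    by (rule p_least) (use S.mono[OF qE pE q_le_p] in \<open>simp add: Sq\<close>)
  ultimately have Sp: "S p = p" by (simp add: antisym)
  \<comment> \<open>Doubling \<open>q n\<close> and cutting at \<open>e\<close> stays below
    \<open>p\<close>, so \<open>inf (q n) (e - q n)\<close> is at most \<open>p - q n\<close>;
    replacing \<open>q n\<close> by \<open>p\<close> costs the same amount once more.\<close>
  have "inf p (e - p) \<le> 0"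
  proof (rule null_seqD[OF null_seq_add[OF null null]])
    fix n
    have "2 *\<^sub>R q n \<le> real (2 * n) *\<^sub>R ?x"
      using scaleR_left_mono[OF qx[of n], of 2] by simp
    then have "inf (q n + q n) e \<le> q (2 * n)" unfolding q_def[of "2 * n"] scaleR_2
      by (intro inf_mono order_refl)
    also have "\<dots> \<le> p" by (rule q_le_p)
    finally have "inf (q n + q n) e - q n \<le> p - q n" by (rule diff_right_mono)
    then have qq: "inf (q n) (e - q n) \<le> p - q n" unfolding inf_diff_right by simp
    have "e - p \<le> (e - q n) + (p - q n)"
      using q_le_p[of n] by (intro add_increasing2 diff_left_mono) simp_all
    then have "inf p (e - p) \<le> inf (q n + (p - q n)) ((e - q n) + (p - q n))"
      by (intro inf_mono) simp_all
    also have "\<dots> = inf (q n) (e - q n) + (p - q n)" by (rule add_inf_distrib_right[symmetric])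
    also have "\<dots> \<le> (p - q n) + (p - q n)" by (rule add_right_mono[OF qq])
    finally show "inf p (e - p) \<le> (p - q n) + (p - q n)" .
  qed
  moreover have "0 \<le> inf p (e - p)" using p0 p_le_e by simp
  ultimately have comp: "inf p (e - p) = 0" by (rule antisym)
  have "inf ?n p \<le> 0"
  proof (rule inf_disjoint_Sup_le)
    fix y assume "y \<in> range q"
    then obtain n where n: "y = q n" by blast
    have "inf (1 *\<^sub>R ?n) (real n *\<^sub>R ?x) = 0"
      by (rule disjoint_scaleR) (use inf_pos_neg[of x] in \<open>simp_all add: inf_commute\<close>)
    then have "inf ?n (real n *\<^sub>R ?x) = 0" by simp
    moreover have "inf ?n (q n) \<le> inf ?n (real n *\<^sub>R ?x)" by (intro inf_mono order_refl qx)
    ultimately show "inf ?n y \<le> 0" by (simp only: n)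
    show "y \<le> p" unfolding n by (rule q_le_p)
  next
    fix u assume "\<And>y. y \<in> range q \<Longrightarrow> y \<le> u"
    then show "p \<le> u" by (intro p_least) blast
  qed
  moreover have "0 \<le> inf ?n p" using p0 by simp
  ultimately have "p * ?n = 0" using disjoint_mult_eq_0[of ?n p] by (simp add: antisym mult.commute)
  \<comment> \<open>The left-hand side lies below both \<open>e\<close> and the positive part of
    \<open>x\<close>, hence below \<open>q 1\<close> and so below \<open>p\<close>. Thus
    \<open>p\<close> acts as the identity on the positive part.\<close>
  have "inf (e - p) ?x \<le> inf p (e - p)"
  proof (rule inf_greatest[OF _ inf.cobounded1])
    have "inf (e - p) ?x \<le> e" using p0 by (intro le_infI1) simp
    then have "inf (e - p) ?x \<le> q 1" unfolding q_def by simp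
    then show "inf (e - p) ?x \<le> p" using q_le_p order_trans by blast
  qed
  moreover have "0 \<le> inf (e - p) ?x" using p_le_e by simp
  ultimately have "inf (e - p) ?x = 0" unfolding comp by (simp add: antisym)
  from disjoint_mult_eq_0[OF this] have "p * ?x = ?x" by (simp add: left_diff_distrib unit)
  with \<open>p * ?n = 0\<close> have "p * (?x - ?n) = ?x" by (simp only: right_diff_distrib diff_0_right)
  then have "p * x = ?x" unfolding pos_diff_neg .
  with Sp comp pE show ?thesis unfolding components_of_def by blast
qed

text \<open>Bounded invariant elements are handled by their carriers, positive ones by truncation,
  and general ones by their positive and negative parts.\<close>

lemma ergodic_if_components:
  assumes conv: "\<And>p. p \<in> components_of E e \<Longrightarrow> averages_converge E T S p p"
  shows "ergodic E T S"
proof -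
  have bounded: "T f = f" if f: "f \<in> B" "S f = f" for f
  proof -
    let ?x = "f - T f"
    have fE: "f \<in> E" by (rule B_E[OF f(1)])
    have xB: "?x \<in> B" by (intro B_diff T.in_B f)
    \<comment> \<open>Bounded elements of the range of \<open>T\<close> are invariant, so
      \<open>f - T f\<close> is invariant and has an invariant carrier.\<close>
    have "S (T f) = T f" by (intro S_fixes_range T.in_B f T_projection fE)
    then have Sx: "S ?x = ?x" by (simp add: S.diff fE T.in_E f(2))
    obtain p where p: "p \<in> components_of E e" "S p = p" "p * ?x = sup ?x 0"
      using invariant_carrier[OF B_E[OF xB] Sx] by blast
    have Tp: "T p = p" by (rule invariant_component[OF p(1,2) conv[OF p(1)]])
    have "T (sup ?x 0) = p * T ?x"
      unfolding p(3)[symmetric] using components_subset_B p(1) by (intro averaging Tp xB) blast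
    also have "T ?x = 0" by (simp add: T.diff fE T.in_E T_projection)
    finally have "sup ?x 0 = 0"
      by (intro T_eq_0 E_sup E_zero B_E[OF xB]) simp_all
    then have "?x \<le> 0" by (metis sup.cobounded1)
    then show "T f = f" by (intro T_eq_if_le fE) simp
  qed
  have pos: "T f = f" if f: "f \<in> E" "0 \<le> f" "S f = f" for f
  proof -
    have fixed: "T (trunc n f) = trunc n f" for n
    proof (rule bounded[OF trunc_in_B[OF f(2)]])
      show "S (trunc n f) = trunc n f"
        unfolding trunc_def by (simp add: S_inf f ne_in_E S.scaleR e_in_E S_unit)
    qed
    have "f - T f \<le> 0"
    proof (rule null_seqD[OF trunc_null])
      show "f - T f \<le> f - trunc n f" for n
        using T.mono[OF trunc_in_E[OF f(2)] f(1) trunc_le] unfolding fixed by (rule diff_left_mono)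
    qed
    then show ?thesis by (intro T_eq_if_le f) simp
  qed
  show ?thesis
    unfolding ergodic_def
  proof (intro ballI impI)
    fix f assume f: "f \<in> E" "S f = f"
    have E: "sup f 0 \<in> E" "sup (- f) 0 \<in> E" by (intro E_sup E_uminus E_zero f)+
    have "S (sup f 0) = sup f 0" "S (sup (- f) 0) = sup (- f) 0"
      using S_sup[OF f(1) E_zero] S_sup[OF E_uminus[OF f(1)] E_zero]
      by (simp_all add: f(2) S.zero S.uminus f(1))
    then have "T (sup f 0) = sup f 0" "T (sup (- f) 0) = sup (- f) 0"
      by (auto intro: pos E)
    then have "T (sup f 0 - sup (- f) 0) = sup f 0 - sup (- f) 0"
      by (simp only: T.diff E)
    then show "T f = f" unfolding pos_diff_neg .
  qed
qed

end

theorem theorem12: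
  fixes E :: "'a::universally_complete_f_algebra set"
    and T S :: "'a \<Rightarrow> 'a" and e :: 'a
  assumes "conditional_expectation_preserving_system E T S e"
    and "order_dense E"
    and "\<And>x. e * x = x"
  shows "(ergodic E T S \<longleftrightarrow> (\<forall>f\<in>Linf E T. \<forall>g\<in>L1 E T. averages_converge E T S f g)) \<and>
         (ergodic E T S \<longleftrightarrow> (\<forall>f\<in>principal_ideal E e. \<forall>g\<in>principal_ideal E e. averages_converge E T S f g)) \<and>
         (ergodic E T S \<longleftrightarrow> (\<forall>f\<in>components_of E e. \<forall>g\<in>components_of E e. averages_converge E T S f g)) \<and>
         (ergodic E T S \<longleftrightarrow> (\<forall>f\<in>principal_ideal E e. averages_converge E T S f f)) \<and>
         (ergodic E T S \<longleftrightarrow> (\<forall>f\<in>components_of E e. averages_converge E T S f f))"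
proof -
  interpret expectation_preserving E T S e
    using assms by (simp add: expectation_preserving_def expectation_preserving_axioms_def)
  have "principal_ideal E e \<subseteq> L1 E T"
    using E_subset_L1 B_E by blast
  note subsets = components_subset_B B_subset_Linf this
  \<comment> \<open>Ergodicity gives the strongest convergence statement by \<open>mixing\<close>,
    the weakest one, for equal components, gives ergodicity back, and the inclusions place the
    others in between.\<close>
  show ?thesis
    using mixing ergodic_if_components subsets by (meson subsetD)
qed

end
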